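(* (i) The mixed discriminant of positive definite (respectively non-negative definite) hyperhermitian $n\times n$ quaternionic matrices $A_1,\dots,A_n$ is positive (respectively non-negative). (ii) Let $n\ge 2$ and fix positive definite hyperhermitian $n\times n$ matrices $A_1,\dots,A_{n-2}$. On the real linear space of hyperhermitian $n\times n$ matrices consider the bilinear form $$B(X,Y):=\det(X,Y,A_1,\dots,A_{n-2}).$$ Then $B$ is a non-degenerate quadratic form, and its signature has one plus and the rest are minuses.
   Context: $\mathbb{H}$ is the skew field of quaternions. A quaternionic square matrix $A=(a_{ij})$ is hyperhermitian if $a_{ij}=\overline{a_{ji}}$ for all $i,j$. It is positive (resp. non-negative) definite if $\sum_{i,j}\bar x_i a_{ij}x_j>0$ (resp. $\ge 0$) for every non-zero $x\in\mathbb{H}^n$. Moore determinant: for a hyperhermitian $n\times n$ matrix $A$ let ${}^{\mathbb R}A$ be the real $4n\times 4n$ matrix of the symmetric bilinear form $(x,y)\mapsto \mathrm{Re}\sum_{i,j}\bar x_i a_{ij}y_j$ on $\mathbb{H}^n\cong\mathbb{R}^{4n}$. There is a unique polynomial $P$ on the real vector space of hyperhermitian $n\times n$ matrices with $\det({}^{\mathbb R}A)=P(A)^4$ for all $A$ and $P(\mathrm{Id})=1$; the Moore determinant is $\det A:=P(A)\in\mathbb{R}$. (If $A=C^*\mathrm{diag}(\lambda_1,\dots,\lambda_n)C$ with $\lambda_i\in\mathbb{R}$ and $C^*C=\mathrm{Id}$, then $\det A=\prod_i\lambda_i$.) Mixed discriminant: for hyperhermitian $n\times n$ matrices $A_1,\dots,A_n$,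 $\det(A_1,\dots,A_n)$ is $\frac{1}{n!}$ times the coefficient of $\lambda_1\cdots\lambda_n$ in the polynomial $\det(\lambda_1A_1+\dots+\lambda_nA_n)$ of the real variables $\lambda_1,\dots,\lambda_n$. *)

theory Defs
  imports "HOL-Analysis.Analysis" "HOL-Library.Poly_Mapping"
begin

section \<open>The skew field of quaternions\<close>

datatype quat = Quat (qRe: real) (qI: real) (qJ: real) (qK: real)

lemma quat_eq_iff: "x = y \<longleftrightarrow> qRe x = qRe y \<and> qI x = qI y \<and> qJ x = qJ y \<and> qK x = qK y"
  by (cases x; cases y) simp

definition qcnj :: "quat \<Rightarrow> quat"
  where "qcnj x = Quat (qRe x) (- qI x) (- qJ x) (- qK x)"

lemma qcnj_sel [simp]:
  "qRe (qcnj x) = qRe x" "qI (qcnj x) = - qI x" "qJ (qcnj x) = - qJ x" "qK (qcnj x) = - qK x"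
  by (simp_all add: qcnj_def)

instantiation quat :: ab_group_add
begin

definition zero_quat where "0 = Quat 0 0 0 0"
definition plus_quat where
  "x + y = Quat (qRe x + qRe y) (qI x + qI y) (qJ x + qJ y) (qK x + qK y)"
definition uminus_quat where "- x = Quat (- qRe x) (- qI x) (- qJ x) (- qK x)"
definition minus_quat where
  "x - y = Quat (qRe x - qRe y) (qI x - qI y) (qJ x - qJ y) (qK x - qK y)"

instance
  by standard (auto simp: zero_quat_def plus_quat_def uminus_quat_def minus_quat_def quat_eq_iff)

end

lemma quat_add_sel [simp]:
  "qRe 0 = 0" "qI 0 = 0" "qJ 0 = 0" "qK 0 = 0"
  "qRe (x + y) = qRe x + qRe y" "qI (x + y) = qI x + qI y"
  "qJ (x + y) = qJ x + qJ y" "qK (x + y) = qK x + qK y"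
  "qRe (- x) = - qRe x" "qI (- x) = - qI x" "qJ (- x) = - qJ x" "qK (- x) = - qK x"
  "qRe (x - y) = qRe x - qRe y" "qI (x - y) = qI x - qI y"
  "qJ (x - y) = qJ x - qJ y" "qK (x - y) = qK x - qK y"
  by (simp_all add: zero_quat_def plus_quat_def uminus_quat_def minus_quat_def)

instantiation quat :: real_algebra_1
begin

definition one_quat where "1 = Quat 1 0 0 0"
definition times_quat where
  "x * y = Quat
     (qRe x * qRe y - qI x * qI y - qJ x * qJ y - qK x * qK y)
     (qRe x * qI y + qI x * qRe y + qJ x * qK y - qK x * qJ y)
     (qRe x * qJ y - qI x * qK y + qJ x * qRe y + qK x * qI y)
     (qRe x * qK y + qI x * qJ y - qJ x * qI y + qK x * qRe y)"
definition scaleR_quat where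
  "scaleR r x = Quat (r * qRe x) (r * qI x) (r * qJ x) (r * qK x)"

instance
  by standard
    (auto simp: one_quat_def times_quat_def scaleR_quat_def quat_eq_iff algebra_simps)

end

lemma quat_mult_sel [simp]:
  "qRe 1 = 1" "qI 1 = 0" "qJ 1 = 0" "qK 1 = 0"
  "qRe (x * y) = qRe x * qRe y - qI x * qI y - qJ x * qJ y - qK x * qK y"
  "qI (x * y) = qRe x * qI y + qI x * qRe y + qJ x * qK y - qK x * qJ y"
  "qJ (x * y) = qRe x * qJ y - qI x * qK y + qJ x * qRe y + qK x * qI y"
  "qK (x * y) = qRe x * qK y + qI x * qJ y - qJ x * qI y + qK x * qRe y"
  "qRe (r *\<^sub>R x) = r * qRe x" "qI (r *\<^sub>R x) = r * qI x"
  "qJ (r *\<^sub>R x) = r * qJ x" "qK (r *\<^sub>R x) = r * qK x"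
  by (simp_all add: one_quat_def times_quat_def scaleR_quat_def)

lemma quat_of_real_sel [simp]:
  "qRe (of_real r) = r" "qI (of_real r) = 0" "qJ (of_real r) = 0" "qK (of_real r) = 0"
  by (simp_all add: of_real_def)

lemma qnormsq_eq_0_iff:
  "(qRe x)\<^sup>2 + (qI x)\<^sup>2 + (qJ x)\<^sup>2 + (qK x)\<^sup>2 = 0 \<longleftrightarrow> x = 0"
  by (auto simp: quat_eq_iff add_nonneg_eq_0_iff)

instantiation quat :: real_div_algebra
begin

definition inverse_quat where
  "inverse x = qcnj x /\<^sub>R ((qRe x)\<^sup>2 + (qI x)\<^sup>2 + (qJ x)\<^sup>2 + (qK x)\<^sup>2)"
definition divide_quat where "x div y = x * inverse (y :: quat)"

instance
proof
  fix x y :: quat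
  show "inverse x * x = 1" if "x \<noteq> 0"
  proof -
    let ?N = "(qRe x)\<^sup>2 + (qI x)\<^sup>2 + (qJ x)\<^sup>2 + (qK x)\<^sup>2"
    have "inverse x * x = inverse ?N *\<^sub>R (qcnj x * x)"
      by (simp add: inverse_quat_def)
    also have "qcnj x * x = ?N *\<^sub>R 1"
      by (simp add: quat_eq_iff power2_eq_square)
    finally show ?thesis
      using that qnormsq_eq_0_iff[of x] by simp
  qed
  show "x * inverse x = 1" if "x \<noteq> 0"
  proof -
    let ?N = "(qRe x)\<^sup>2 + (qI x)\<^sup>2 + (qJ x)\<^sup>2 + (qK x)\<^sup>2"
    have "x * inverse x = inverse ?N *\<^sub>R (x * qcnj x)"
      by (simp add: inverse_quat_def)
    also have "x * qcnj x = ?N *\<^sub>R 1"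
      by (simp add: quat_eq_iff power2_eq_square)
    finally show ?thesis
      using that qnormsq_eq_0_iff[of x] by simp
  qed
  show "x div y = x * inverse y"
    by (rule divide_quat_def)
  show "inverse (0 :: quat) = 0"
    by (simp add: inverse_quat_def quat_eq_iff)
qed

end

instantiation quat :: real_inner
begin

definition inner_quat where
  "inner x y = qRe x * qRe y + qI x * qI y + qJ x * qJ y + qK x * qK y"
definition norm_quat where "norm (x :: quat) = sqrt (inner x x)"
definition sgn_quat where "sgn x = x /\<^sub>R norm (x :: quat)"
definition dist_quat where "dist x y = norm (x - y :: quat)"
definition uniformity_quat where
  "(uniformity :: (quat \<times> quat) filter) = (INF e\<in>{0<..}. principal {(x, y). dist x y < e})"
definition open_quat where
  "open (U :: quat set) \<longleftrightarrow> (\<forall>x\<in>U. eventually (\<lambda>(x', y). x' = x \<longrightarrow> y \<in> U) uniformity)"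

instance
proof
  fix x :: quat
  show "inner x x = 0 \<longleftrightarrow> x = 0"
    using qnormsq_eq_0_iff[of x] by (simp add: inner_quat_def power2_eq_square)
qed (simp_all add: inner_quat_def norm_quat_def sgn_quat_def dist_quat_def uniformity_quat_def
      open_quat_def algebra_simps)

end

instantiation quat :: euclidean_space
begin

definition Basis_quat where "Basis = {1, Quat 0 1 0 0, Quat 0 0 1 0, Quat 0 0 0 1}"

instance
proof
  show "inner u v = (if u = v then 1 else 0)" if "u \<in> Basis" "v \<in> Basis" for u v :: quat
    using that unfolding Basis_quat_def
    by (elim insertE emptyE; hypsubst; simp add: inner_quat_def one_quat_def)
  show "(\<forall>u\<in>Basis. inner x u = 0) \<longleftrightarrow> x = 0" for x :: quat
    by (simp add: Basis_quat_def inner_quat_def quat_eq_iff[of x])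
qed (simp_all add: Basis_quat_def)

end

instance quat :: real_normed_div_algebra
proof
  fix x y :: quat
  have "inner (x * y) (x * y) = inner x x * inner y y"
    by (simp add: inner_quat_def algebra_simps)
  then show "norm (x * y) = norm x * norm y"
    by (simp add: norm_quat_def real_sqrt_mult)
qed


section \<open>Hyperhermitian matrices\<close>

definition hyperhermitian :: "quat^'n^'n \<Rightarrow> bool"
  where "hyperhermitian A \<longleftrightarrow> (\<forall>i j. A $ i $ j = qcnj (A $ j $ i))"

definition sesq_form :: "quat^'n^'n \<Rightarrow> quat^'n \<Rightarrow> quat^'n \<Rightarrow> quat"
  where "sesq_form A x y = (\<Sum>i\<in>UNIV. \<Sum>j\<in>UNIV. qcnj (x $ i) * A $ i $ j * y $ j)"

lemma qcnj_sum: "qcnj (\<Sum>i\<in>S. f i) = (\<Sum>i\<in>S. qcnj (f i))"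
  by (induction S rule: infinite_finite_induct) (auto simp: quat_eq_iff)

lemma qcnj_mult: "qcnj (x * y) = qcnj y * qcnj x"
  by (simp add: quat_eq_iff algebra_simps)

lemma qcnj_qcnj [simp]: "qcnj (qcnj x) = x"
  by (simp add: quat_eq_iff)

lemma qcnj_add: "qcnj (x + y) = qcnj x + qcnj y"
  by (simp add: quat_eq_iff)

lemma qcnj_scaleR: "qcnj (r *\<^sub>R x) = r *\<^sub>R qcnj x"
  by (simp add: quat_eq_iff)

lemma hyperhermitianD: "hyperhermitian A \<Longrightarrow> qcnj (A $ i $ j) = A $ j $ i"
  by (metis hyperhermitian_def)

lemma hyperhermitianI: "(\<And>i j. qcnj (A $ i $ j) = A $ j $ i) \<Longrightarrow> hyperhermitian A"
  by (simp add: hyperhermitian_def)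

lemma subspace_hyperhermitian: "subspace {A. hyperhermitian A}"
  unfolding subspace_def
proof (intro conjI ballI allI)
  show "0 \<in> {A :: quat^'n^'n. hyperhermitian A}"
    by (simp add: hyperhermitian_def quat_eq_iff)
qed (auto intro!: hyperhermitianI simp: hyperhermitianD qcnj_add qcnj_scaleR)

text \<open>The value of the form on the diagonal is a real quaternion, so that its sign, which
  is taken below through its real part, is meaningful.\<close>

lemma hyperhermitian_form_real:
  assumes "hyperhermitian A"
  shows "sesq_form A x x = of_real (qRe (sesq_form A x x))"
proof -
  have "qcnj (sesq_form A x x)
      = (\<Sum>i\<in>UNIV. \<Sum>j\<in>UNIV. qcnj (x $ j) * qcnj (A $ i $ j) * x $ i)"
    by (simp add: sesq_form_def qcnj_sum qcnj_mult mult.assoc)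
  also have "\<dots> = (\<Sum>i\<in>UNIV. \<Sum>j\<in>UNIV. qcnj (x $ j) * A $ j $ i * x $ i)"
    using assms by (simp add: hyperhermitianD)
  also have "\<dots> = sesq_form A x x"
    unfolding sesq_form_def by (rule sum.swap)
  finally show ?thesis
    by (simp add: quat_eq_iff)
qed

definition positive_definite :: "quat^'n^'n \<Rightarrow> bool"
  where "positive_definite A \<longleftrightarrow>
    hyperhermitian A \<and> (\<forall>x. x \<noteq> 0 \<longrightarrow> qRe (sesq_form A x x) > 0)"

definition nonneg_definite :: "quat^'n^'n \<Rightarrow> bool"
  where "nonneg_definite A \<longleftrightarrow>
    hyperhermitian A \<and> (\<forall>x. x \<noteq> 0 \<longrightarrow> qRe (sesq_form A x x) \<ge> 0)"


section \<open>The Moore determinant\<close>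

definition quat_unit :: "4 \<Rightarrow> quat"
  where "quat_unit a =
    (if a = 1 then 1 else if a = 2 then Quat 0 1 0 0 else if a = 3 then Quat 0 0 1 0
     else Quat 0 0 0 1)"

text \<open>The real standard basis of the space of quaternionic column vectors, indexed by the
  coordinate and by the quaternion unit; this fixes the identification with the real coordinate
  space of four times the dimension.\<close>

definition real_basis :: "'n \<times> 4 \<Rightarrow> quat^'n"
  where "real_basis p = axis (fst p) (quat_unit (snd p))"

definition real_matrix :: "quat^'n^'n \<Rightarrow> real^('n \<times> 4)^('n \<times> 4)"
  where "real_matrix A = (\<chi> p q. qRe (sesq_form A (real_basis p) (real_basis q)))"

text \<open>A polynomial on the subspace of hyperhermitian matrices is represented by a polynomial on
  the space of all quaternionic matrices restricted to that subspace. Only the values on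
  hyperhermitian matrices are determined, so the determinant below is meaningful for
  hyperhermitian arguments only.\<close>

definition moore_polynomial :: "(quat^'n^'n \<Rightarrow> real) \<Rightarrow> bool"
  where "moore_polynomial P \<longleftrightarrow>
    real_polynomial_function P \<and>
    (\<forall>A. hyperhermitian A \<longrightarrow> det (real_matrix A) = P A ^ 4) \<and>
    P (mat 1) = 1"

definition moore_det :: "quat^'n^'n \<Rightarrow> real"
  where "moore_det A = (THE d. \<exists>P. moore_polynomial P \<and> P A = d)"


section \<open>Mixed discriminants\<close>

text \<open>Polynomials in real variables indexed by the natural numbers, as finitely supported
  coefficient functions on monomials, which are finitely supported exponent functions.\<close>

type_synonym real_mpoly = "(nat \<Rightarrow>\<^sub>0 nat) \<Rightarrow>\<^sub>0 real"

definition mpoly_eval :: "real_mpoly \<Rightarrow> (nat \<Rightarrow> real) \<Rightarrow> real"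
  where "mpoly_eval p x =
    (\<Sum>m\<in>Poly_Mapping.keys p. Poly_Mapping.lookup p m *
      (\<Prod>i\<in>Poly_Mapping.keys m. x i ^ Poly_Mapping.lookup m i))"

definition mpoly_of_fun :: "((nat \<Rightarrow> real) \<Rightarrow> real) \<Rightarrow> real_mpoly"
  where "mpoly_of_fun f = (THE p. \<forall>x. mpoly_eval p x = f x)"

text \<open>The \<open>n\<close> matrices are given as a list of length \<open>n = CARD('n)\<close>; the variables are numbered
  from \<open>0\<close>.\<close>

definition mixed_discriminant :: "(quat^'n^'n) list \<Rightarrow> real"
  where "mixed_discriminant As =
    Poly_Mapping.lookup
      (mpoly_of_fun (\<lambda>l. moore_det (\<Sum>i<CARD('n). l i *\<^sub>R As ! i)))
      (\<Sum>i<CARD('n). Poly_Mapping.single i 1)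
    / fact CARD('n)"


section \<open>Quadratic forms on a subspace\<close>

definition symmetric_bilinear_on ::
    "'a::real_vector set \<Rightarrow> ('a \<Rightarrow> 'a \<Rightarrow> real) \<Rightarrow> bool"
  where "symmetric_bilinear_on V B \<longleftrightarrow>
    (\<forall>X\<in>V. \<forall>Y\<in>V. B X Y = B Y X) \<and>
    (\<forall>X\<in>V. \<forall>Y\<in>V. \<forall>Z\<in>V. \<forall>a b. B (a *\<^sub>R X + b *\<^sub>R Y) Z = a * B X Z + b * B Y Z)"

definition nondegenerate_on :: "'a::real_vector set \<Rightarrow> ('a \<Rightarrow> 'a \<Rightarrow> real) \<Rightarrow> bool"
  where "nondegenerate_on V B \<longleftrightarrow> (\<forall>X\<in>V. (\<forall>Y\<in>V. B X Y = 0) \<longrightarrow> X = 0)"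

text \<open>Signature with \<open>p\<close> pluses and \<open>q\<close> minuses: the numbers of positive and of negative
  diagonal entries of the form in an orthogonal basis. By Sylvester's law of inertia they do not
  depend on the basis.\<close>

definition has_signature_on ::
    "'a::real_vector set \<Rightarrow> ('a \<Rightarrow> 'a \<Rightarrow> real) \<Rightarrow> nat \<Rightarrow> nat \<Rightarrow> bool"
  where "has_signature_on V B p q \<longleftrightarrow>
    (\<exists>E. finite E \<and> independent E \<and> span E = V \<and>
      (\<forall>e\<in>E. \<forall>e'\<in>E. e \<noteq> e' \<longrightarrow> B e e' = 0) \<and>
      card {e\<in>E. B e e > 0} = p \<and> card {e\<in>E. B e e < 0} = q)"

end

theory Submission
  imports Defs "HOL-Computational_Algebra.Computational_Algebra"
begin

text \<open>The argument treats the Moore determinant as a hyperbolic polynomial, in the sense of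
  Garding, and reads both claims off the zeros of its polarization.

  \<^item> A hyperhermitian matrix has an orthonormal basis of right eigenvectors with real
  eigenvalues (\<open>eigensystem_exists\<close>). Multiplying an eigenvector on the right by the four
  quaternion units shows that the real matrix repeats each eigenvalue four times, so its
  determinant is the fourth power of the product of the eigenvalues. That product is a polynomial
  in the entries: by Newton's identities it is a polynomial in the power sums of the eigenvalues,
  and these are a quarter of the traces of powers of the real matrix (\<open>elementary_symmetric_polynomial\<close>). This
  gives the Moore polynomial \<open>P\<close>. It is unique, because two fourth roots with the value \<open>1\<close> at
  the identity agree along every line through the identity.

  \<^item> A homogeneous polynomial of degree \<open>n\<close> is the diagonal of a symmetric \<open>n\<close>-linear form. Here
  it is written as a sum of products of \<open>n\<close> linear functionals, which are then distributed over
  the \<open>n\<close> arguments in all possible orders (\<open>polar\<close>). The form makes sense over the complex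
  numbers as well, and on lists of hyperhermitian matrices it is the mixed discriminant
  (\<open>coefficient_of_polar\<close>).

  \<^item> The fourth power of \<open>P\<close> at \<open>X + iY\<close> is the determinant of the complex matrix with real part the
  real matrix of \<open>X\<close> and imaginary part that of \<open>Y\<close>. Such a matrix is invertible if \<open>Y\<close> is positive
  definite, so \<open>P\<close> has no zeros there (\<open>polar_moore_complex_nonzero\<close>).

  \<^item> This absence of zeros passes to derivatives in positive directions. Along a positive
  direction \<open>A\<close> all zeros lie in the open lower half-plane, hence the derivative at the origin
  does not vanish, by the theorem of Gauss and Lucas. Each step replaces one of the equal arguments
  of the polarized form by \<open>A\<close>; after \<open>n\<close> steps mixed discriminants of positive definite matrices are
  seen to be positive (\<open>hyperbolic_derivative\<close>), and the non-negative case is a limit.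

  \<^item> After \<open>n - 2\<close> steps a quadratic form \<open>B\<close> is left. If \<open>B X Y = 0\<close>, \<open>Y\<close> is positive definite and
  \<open>B X X\<close> were positive, then \<open>X + itY\<close> would be a zero for a suitable \<open>t > 0\<close>. So \<open>B\<close> is
  negative semidefinite on the orthogonal complement of \<open>Y\<close> (\<open>D_hodge\<close>), and has the claimed
  signature once it is non-degenerate.

  \<^item> The radical of \<open>B\<close> does not depend on the fixed positive definite matrices
  (\<open>radical_change_one\<close>), so all of them may be taken to be the identity. There, membership of \<open>X\<close>
  in the radical makes the first two elementary symmetric functions of its eigenvalues vanish.
  Then the sum of their squares vanishes, and \<open>X = 0\<close> (\<open>radical_at_identity\<close>).\<close>

section \<open>Spectral theorem for hyperhermitian matrices\<close>

text \<open>Near \<open>t = 0\<close> the linear term decides the sign, and it takes both signs unless \<open>a = 0\<close>. All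
  first-order conditions below (at a maximum, or on the null vectors of a semidefinite form) are
  instances of this.\<close>

lemma linear_dominates_quadratic:
  fixes a b :: real
  assumes "\<And>t. 2 * t * a + t\<^sup>2 * b \<le> 0"
  shows "a = 0"
proof (rule ccontr)
  assume a: "a \<noteq> 0"
  \<comment> \<open>With this choice \<open>t * a\<close> equals \<open>t\<^sup>2 * (\<bar>b\<bar> + 1)\<close> and so outweighs the quadratic term.\<close>
  define t where "t = a / (\<bar>b\<bar> + 1)"
  have "t\<^sup>2 * b \<ge> - (t\<^sup>2 * (\<bar>b\<bar> + 1))"
    by (smt (verit) mult_minus_right mult_left_mono zero_le_power2)
  moreover have "t\<^sup>2 * (\<bar>b\<bar> + 1) = t * a"
    by (simp add: t_def power2_eq_square)
  moreover have "t * a > 0"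
    using a by (simp add: t_def zero_less_mult_iff zero_less_divide_iff) (auto simp: neq_iff)
  ultimately show False
    using assms[of t] by linarith
qed

text \<open>A maximum point \<open>x\<close> of the Rayleigh quotient on the unit sphere of \<open>W\<close> exists by compactness.
  The first-order condition at \<open>x\<close> says that \<open>T x - l *\<^sub>R x\<close> is orthogonal to \<open>W\<close>; as \<open>W\<close> is invariant,
  this vector itself lies in \<open>W\<close>, so it is zero.\<close>

lemma selfadjoint_eigenvector_in_subspace:
  fixes T :: "'a::euclidean_space \<Rightarrow> 'a"
  assumes T: "linear T" and sym: "\<And>x y. T x \<bullet> y = x \<bullet> T y"
    and W: "subspace W" and inv: "\<And>x. x \<in> W \<Longrightarrow> T x \<in> W" and ne: "w \<in> W" "w \<noteq> 0"
  obtains x l where "x \<in> W" "norm x = 1" "T x = l *\<^sub>R x"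
proof -
  let ?S = "sphere 0 1 \<inter> W"
  have "compact ?S"
    by (intro compact_Int_closed closed_subspace W) auto
  moreover have "w /\<^sub>R norm w \<in> ?S"
    using ne W by (simp add: subspace_scale)
  moreover have "continuous_on ?S (\<lambda>x. x \<bullet> T x)"
    by (intro continuous_intros linear_continuous_on_compose[OF continuous_on_id T, unfolded id_def])
  ultimately obtain x where x: "x \<in> ?S" and max: "\<And>y. y \<in> ?S \<Longrightarrow> y \<bullet> T y \<le> x \<bullet> T x"
    using continuous_attains_sup[of ?S "\<lambda>x. x \<bullet> T x"] by blast
  define l where "l = x \<bullet> T x"
  have xx: "x \<bullet> x = 1" using x by (simp add: norm_eq_1)
  have le: "y \<bullet> T y \<le> l * (y \<bullet> y)" if y: "y \<in> W" for y
  proof (cases "y = 0")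
    case False
    have "y /\<^sub>R norm y \<in> ?S"
      using False y W by (simp add: subspace_scale)
    from max[OF this] have "(y \<bullet> T y) / (norm y)\<^sup>2 \<le> l"
      using False by (simp add: linear_scale[OF T] l_def power2_eq_square field_simps)
    then show ?thesis
      using False by (simp add: divide_le_eq power2_norm_eq_inner)
  qed simp
  have orth: "y \<bullet> (T x - l *\<^sub>R x) = 0" if y: "y \<in> W" for y
  proof (rule linear_dominates_quadratic)
    fix t
    have "x + t *\<^sub>R y \<in> W"
      using x y W by (simp add: subspace_add subspace_scale)
    from le[OF this] have "2 * t * (y \<bullet> T x - l * (y \<bullet> x)) + t\<^sup>2 * (y \<bullet> T y - l * (y \<bullet> y)) \<le> 0"
      using sym[of x y] by (simp add: linear_add[OF T] linear_scale[OF T] inner_add inner_commute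
          l_def[symmetric] xx power2_eq_square algebra_simps)
    then show "2 * t * (y \<bullet> (T x - l *\<^sub>R x)) + t\<^sup>2 * (y \<bullet> T y - l * (y \<bullet> y)) \<le> 0"
      by (simp add: inner_diff_right)
  qed
  have "T x - l *\<^sub>R x \<in> W"
    using x W inv by (simp add: subspace_diff subspace_scale)
  from orth[OF this] have "T x = l *\<^sub>R x"
    by simp
  then show thesis using that x by auto
qed

text \<open>The quaternionic Hermitian product. Matrices act from the left, so scalars act from the right
  (\<open>rmul\<close>), and the product is linear over the quaternions in its second argument.\<close>

definition qip :: "quat^'n \<Rightarrow> quat^'n \<Rightarrow> quat"
  where "qip x y = (\<Sum>k\<in>UNIV. qcnj (x $ k) * y $ k)"

definition rmul :: "quat^'n \<Rightarrow> quat \<Rightarrow> quat^'n"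
  where "rmul x h = (\<chi> k. x $ k * h)"

lemma qRe_sum: "qRe (\<Sum>i\<in>S. f i) = (\<Sum>i\<in>S. qRe (f i))"
  by (induction S rule: infinite_finite_induct) auto

lemma inner_eq_qip: "x \<bullet> y = qRe (qip x y)"
  by (simp add: qip_def inner_vec_def qRe_sum inner_quat_def)

lemma qcnj_qip: "qcnj (qip x y) = qip y x"
  by (simp add: qip_def qcnj_sum qcnj_mult)

lemma qip_rmul_right: "qip x (rmul y h) = qip x y * h"
  by (simp add: qip_def rmul_def sum_distrib_right mult.assoc)

lemma qip_rmul_left: "qip (rmul x h) y = qcnj h * qip x y"
  by (simp add: qip_def rmul_def sum_distrib_left mult.assoc qcnj_mult)

lemma linear_qip: "linear (qip x)"
  by (intro linearI) (simp_all add: qip_def distrib_left sum.distrib scaleR_sum_right)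

lemma linear_quat_matrix: "linear ((*v) (A :: quat^'n^'n))"
  by (intro linearI)
     (simp_all add: matrix_vector_mult_def vec_eq_iff distrib_left sum.distrib scaleR_sum_right)

lemma quat_matrix_rmul: "A *v rmul x h = rmul (A *v x) h"
  by (simp add: matrix_vector_mult_def rmul_def vec_eq_iff sum_distrib_right mult.assoc)

lemma sesq_form_eq_qip: "sesq_form A x y = qip x (A *v y)"
  by (simp add: sesq_form_def qip_def matrix_vector_mult_def sum_distrib_left mult.assoc)

lemma hyperhermitian_qip:
  assumes "hyperhermitian A"
  shows "qip (A *v x) y = qip x (A *v y)"
proof -
  have "qip (A *v x) y = (\<Sum>i\<in>UNIV. \<Sum>j\<in>UNIV. qcnj (x $ j) * A $ j $ i * y $ i)"
    using hyperhermitianD[OF assms]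
    by (simp add: qip_def matrix_vector_mult_def qcnj_sum qcnj_mult sum_distrib_right)
  also have "\<dots> = qip x (A *v y)"
    unfolding sesq_form_eq_qip[symmetric] sesq_form_def by (rule sum.swap)
  finally show ?thesis .
qed

lemma hyperhermitian_inner:
  "hyperhermitian A \<Longrightarrow> (A *v x) \<bullet> y = x \<bullet> (A *v y)"
  by (simp add: inner_eq_qip hyperhermitian_qip)

lemma qip_self: "qip x x = of_real ((norm x)\<^sup>2)"
proof -
  have "qcnj (qip x x) = qip x x" by (rule qcnj_qip)
  then have "qip x x = of_real (qRe (qip x x))"
    by (simp add: quat_eq_iff)
  then show ?thesis
    by (simp add: inner_eq_qip[symmetric] power2_norm_eq_inner)
qed

definition eigensystem :: "quat^'n^'n \<Rightarrow> ('n \<Rightarrow> real) \<Rightarrow> ('n \<Rightarrow> quat^'n) \<Rightarrow> bool"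
  where "eigensystem A l v \<longleftrightarrow> (\<forall>i. A *v v i = l i *\<^sub>R v i) \<and>
    (\<forall>i j. qip (v i) (v j) = (if i = j then 1 else 0))"

text \<open>This is a dimension count over the quaternions which avoids their linear algebra: the products
  with the vectors of \<open>S\<close>, placed at the indices in \<open>S\<close>, form a real linear endomorphism that misses
  every vector with a nonzero entry at \<open>j\<close>. So it is not injective either.\<close>

lemma ex_orthogonal_quat_vector:
  fixes v :: "'n \<Rightarrow> quat^'n"
  assumes "j \<notin> S"
  obtains x where "x \<noteq> 0" "\<And>i. i \<in> S \<Longrightarrow> qip (v i) x = 0"
proof -
  define L :: "quat^'n \<Rightarrow> quat^'n" where "L x = (\<chi> i. if i \<in> S then qip (v i) x else 0)" for x
  have "linear L"
    by (intro linearI) (auto simp: L_def vec_eq_iff linear_add[OF linear_qip] linear_scale[OF linear_qip])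
  moreover have "\<not> surj L"
  proof
    assume "surj L"
    then obtain x where "L x = axis j 1" by (metis surjD)
    then have "L x $ j = 1" by simp
    then show False using assms by (simp add: L_def)
  qed
  ultimately have "\<not> inj L"
    using linear_injective_imp_surjective by blast
  then obtain x where "x \<noteq> 0" "L x = 0"
    using linear_injective_0[OF \<open>linear L\<close>] by blast
  then show thesis
    by (intro that[of x]) (auto simp: L_def vec_eq_iff split: if_splits)
qed

text \<open>The orthogonal complement of the eigenvectors found so far is nonzero and invariant under \<open>A\<close>, and
  therefore contains another eigenvector. Orthogonality is taken for the quaternionic product, so that the right
  multiples of the new vector remain orthogonal to the old ones.\<close>

lemma eigensystem_on_exists:
  fixes A :: "quat^'n^'n"
  assumes A: "hyperhermitian A" and "finite (S :: 'n set)"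
  shows "\<exists>l v. (\<forall>i\<in>S. A *v v i = l i *\<^sub>R v i) \<and>
    (\<forall>i\<in>S. \<forall>j\<in>S. qip (v i) (v j) = (if i = j then 1 else 0))"
  using assms(2)
proof (induction S)
  case (insert j S)
  then obtain l v where ev: "\<And>i. i \<in> S \<Longrightarrow> A *v v i = l i *\<^sub>R v i"
    and on: "\<And>i k. i \<in> S \<Longrightarrow> k \<in> S \<Longrightarrow> qip (v i) (v k) = (if i = k then 1 else 0)"
    by blast
  define W where "W = {x. \<forall>i\<in>S. qip (v i) x = 0}"
  have W: "subspace W"
    unfolding W_def subspace_def
    by (auto simp: linear_add[OF linear_qip] linear_scale[OF linear_qip] linear_0[OF linear_qip])
  obtain w where w: "w \<in> W" "w \<noteq> 0"
  proof (rule ex_orthogonal_quat_vector[OF insert.hyps(2), of v])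
    fix x assume "x \<noteq> 0" "\<And>i. i \<in> S \<Longrightarrow> qip (v i) x = 0"
    then show thesis by (intro that[of x]) (auto simp: W_def)
  qed
  have inv: "A *v x \<in> W" if "x \<in> W" for x
  proof -
    have "qip (v i) (A *v x) = 0" if i: "i \<in> S" for i
    proof -
      have "qcnj (qip (v i) (A *v x)) = qip x (A *v v i)"
        by (simp add: qcnj_qip hyperhermitian_qip[OF A])
      also have "\<dots> = l i *\<^sub>R qcnj (qip (v i) x)"
        by (simp add: ev[OF i] linear_scale[OF linear_qip] qcnj_qip)
      also have "\<dots> = 0"
        using \<open>x \<in> W\<close> i by (simp add: W_def quat_eq_iff)
      finally show ?thesis by (simp add: quat_eq_iff)
    qed
    then show ?thesis by (simp add: W_def)
  qed
  obtain x c where x: "x \<in> W" "norm x = 1" "A *v x = c *\<^sub>R x"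
    using selfadjoint_eigenvector_in_subspace[OF linear_quat_matrix hyperhermitian_inner[OF A] W _ w] inv
    by metis
  have xx: "qip x x = 1"
    using x(2) by (simp add: qip_self)
  have vx: "qip (v i) x = 0" "qip x (v i) = 0" if "i \<in> S" for i
  proof -
    show "qip (v i) x = 0"
      using x(1) that by (simp add: W_def)
    then show "qip x (v i) = 0"
      using qcnj_qip[of "v i" x] by (simp add: quat_eq_iff)
  qed
  show ?case
  proof (rule exI[of _ "l(j := c)"], rule exI[of _ "v(j := x)"], intro conjI ballI)
    show "A *v (v(j := x)) i = (l(j := c)) i *\<^sub>R (v(j := x)) i" if "i \<in> insert j S" for i
      using that ev x(3) by auto
    show "qip ((v(j := x)) i) ((v(j := x)) k) = (if i = k then 1 else 0)"
      if "i \<in> insert j S" "k \<in> insert j S" for i k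
      using that on xx vx by auto
  qed
qed simp

lemma eigensystem_exists:
  assumes "hyperhermitian A"
  obtains l v where "eigensystem A l v"
proof -
  have "\<exists>l v. eigensystem A l v"
    using eigensystem_on_exists[OF assms finite_class.finite_UNIV] by (simp add: eigensystem_def)
  then show thesis
    using that by blast
qed

lemma eigensystem_affine:
  assumes "eigensystem A l v"
  shows "eigensystem (a *\<^sub>R mat 1 + t *\<^sub>R A) (\<lambda>i. a + t * l i) v"
proof -
  have "(a *\<^sub>R mat 1 + t *\<^sub>R A) *v x = a *\<^sub>R x + t *\<^sub>R (A *v x)" for x
  proof -
    have "(a *\<^sub>R mat 1 + t *\<^sub>R A) *v x = (a *\<^sub>R mat 1) *v x + (t *\<^sub>R A) *v x"
      by (rule matrix_vector_mult_add_rdistrib)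
    moreover have "(b *\<^sub>R B) *v x = b *\<^sub>R (B *v x)" for b and B :: "quat^'a^'a"
      by (simp add: matrix_vector_mult_def vec_eq_iff scaleR_sum_right)
    ultimately show ?thesis by simp
  qed
  with assms show ?thesis
    by (simp add: eigensystem_def algebra_simps)
qed

lemma eigensystem_eigenvalue:
  assumes "eigensystem A l v"
  shows "l i = qRe (sesq_form A (v i) (v i))" "v i \<noteq> 0"
proof -
  show "l i = qRe (sesq_form A (v i) (v i))"
    using assms by (simp add: sesq_form_eq_qip eigensystem_def linear_scale[OF linear_qip])
  have "qip (v i) (v i) = 1"
    using assms by (simp add: eigensystem_def)
  then show "v i \<noteq> 0"
    by (auto simp: linear_0[OF linear_qip])
qed

section \<open>The real matrix of a hyperhermitian matrix\<close>

lemma quat_unit_parseval: "(\<Sum>a\<in>UNIV. (quat_unit a \<bullet> x) * (quat_unit a \<bullet> y)) = x \<bullet> y"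
  by (simp add: sum_4 quat_unit_def inner_quat_def)

lemma real_basis_parseval:
  "(\<Sum>p\<in>UNIV. (real_basis p \<bullet> x) * (real_basis p \<bullet> y)) = x \<bullet> (y :: quat^'n)"
proof -
  have "(\<Sum>p\<in>UNIV. (real_basis p \<bullet> x) * (real_basis p \<bullet> y))
    = (\<Sum>i\<in>UNIV. \<Sum>a\<in>UNIV. (quat_unit a \<bullet> x $ i) * (quat_unit a \<bullet> y $ i))"
    unfolding UNIV_Times_UNIV[symmetric] sum.cartesian_product
    by (auto simp: real_basis_def inner_axis inner_axis' case_prod_unfold intro!: sum.cong)
  then show ?thesis
    by (simp add: quat_unit_parseval inner_vec_def)
qed

lemma real_matrix_nth: "real_matrix A $ p $ q = real_basis p \<bullet> (A *v real_basis q)"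
  by (simp add: real_matrix_def sesq_form_eq_qip inner_eq_qip)

text \<open>The columns are the real coordinates of the eigenvectors multiplied on the right by the four
  units. Right multiplication commutes with the matrix, which is why each eigenvalue occurs four
  times on the diagonal.\<close>

definition eigenmatrix :: "('n::finite \<Rightarrow> quat^'n) \<Rightarrow> real^('n \<times> 4)^('n \<times> 4)"
  where "eigenmatrix v = (\<chi> p q. real_basis p \<bullet> rmul (v (fst q)) (quat_unit (snd q)))"

definition diagonal4 :: "('n::finite \<Rightarrow> real) \<Rightarrow> real^('n \<times> 4)^('n \<times> 4)"
  where "diagonal4 l = (\<chi> p q. if p = q then l (fst q) else 0)"

lemma quat_unit_orthonormal: "qRe (qcnj (quat_unit a) * quat_unit b) = (if a = b then 1 else 0)"
  using exhaust_4[of a] exhaust_4[of b] by (auto simp: quat_unit_def)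

lemma eigenmatrix_orthogonal:
  assumes "eigensystem A l v"
  shows "transpose (eigenmatrix v) ** eigenmatrix v = mat 1"
    "eigenmatrix v ** transpose (eigenmatrix v) = mat 1"
proof -
  have "(transpose (eigenmatrix v) ** eigenmatrix v) $ q $ r = mat 1 $ q $ r" for q r
  proof -
    have "(transpose (eigenmatrix v) ** eigenmatrix v) $ q $ r
      = rmul (v (fst q)) (quat_unit (snd q)) \<bullet> rmul (v (fst r)) (quat_unit (snd r))"
      by (simp add: matrix_matrix_mult_def transpose_def eigenmatrix_def real_basis_parseval)
    also have "\<dots> = mat 1 $ q $ r"
      using assms quat_unit_orthonormal[of "snd q" "snd r"]
      by (auto simp: inner_eq_qip qip_rmul_left qip_rmul_right eigensystem_def mat_def prod_eq_iff
          simp del: quat_mult_sel)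
    finally show ?thesis .
  qed
  then show "transpose (eigenmatrix v) ** eigenmatrix v = mat 1"
    by (simp add: vec_eq_iff)
  then show "eigenmatrix v ** transpose (eigenmatrix v) = mat 1"
    by (simp add: matrix_left_right_inverse)
qed

lemma real_matrix_diagonalize:
  assumes A: "hyperhermitian A" and e: "eigensystem A l v"
  shows "real_matrix A ** eigenmatrix v = eigenmatrix v ** diagonal4 l"
proof -
  have "(real_matrix A ** eigenmatrix v) $ p $ q = (eigenmatrix v ** diagonal4 l) $ p $ q" for p q
  proof -
    let ?c = "rmul (v (fst q)) (quat_unit (snd q))"
    have "(real_matrix A ** eigenmatrix v) $ p $ q = (\<Sum>r\<in>UNIV. (real_basis r \<bullet> (A *v real_basis p)) * (real_basis r \<bullet> ?c))"
    proof -
      have "real_basis p \<bullet> (A *v real_basis r) = real_basis r \<bullet> (A *v real_basis p)" for r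
        using hyperhermitian_inner[OF A, of "real_basis p" "real_basis r"] by (simp add: inner_commute)
      then show ?thesis
        by (simp add: matrix_matrix_mult_def real_matrix_nth eigenmatrix_def)
    qed
    also have "\<dots> = real_basis p \<bullet> (A *v ?c)"
      by (simp add: real_basis_parseval hyperhermitian_inner[OF A])
    also have "A *v ?c = l (fst q) *\<^sub>R ?c"
      using e by (simp add: quat_matrix_rmul eigensystem_def) (simp add: rmul_def vec_eq_iff)
    also have "real_basis p \<bullet> (l (fst q) *\<^sub>R ?c) = (eigenmatrix v ** diagonal4 l) $ p $ q"
      by (simp add: matrix_matrix_mult_def diagonal4_def eigenmatrix_def if_distrib cong: if_cong)
    finally show ?thesis .
  qed
  then show ?thesis by (simp add: vec_eq_iff)
qed

lemma prod_fst_4: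
  fixes f :: "'n::finite \<Rightarrow> real"
  shows "(\<Prod>p\<in>(UNIV :: ('n \<times> 4) set). f (fst p)) = (\<Prod>i\<in>UNIV. f i) ^ 4"
proof -
  have "(\<Prod>p\<in>(UNIV :: ('n \<times> 4) set). f (fst p)) = (\<Prod>i\<in>UNIV. \<Prod>a\<in>(UNIV :: 4 set). f i)"
    unfolding UNIV_Times_UNIV[symmetric] prod.cartesian_product by (simp add: case_prod_unfold)
  then show ?thesis
    by (simp add: prod_power_distrib)
qed

lemma sum_fst_4:
  fixes f :: "'n::finite \<Rightarrow> real"
  shows "(\<Sum>p\<in>(UNIV :: ('n \<times> 4) set). f (fst p)) = 4 * (\<Sum>i\<in>UNIV. f i)"
proof -
  have "(\<Sum>p\<in>(UNIV :: ('n \<times> 4) set). f (fst p)) = (\<Sum>i\<in>UNIV. \<Sum>a\<in>(UNIV :: 4 set). f i)"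
    unfolding UNIV_Times_UNIV[symmetric] sum.cartesian_product by (simp add: case_prod_unfold)
  then show ?thesis
    by (simp add: sum_distrib_left)
qed

lemma det_real_matrix:
  fixes A :: "quat^'n^'n"
  assumes A: "hyperhermitian A" and e: "eigensystem A l v"
  shows "det (real_matrix A) = (\<Prod>i\<in>UNIV. l i) ^ 4"
proof -
  let ?Q = "eigenmatrix v"
  have d: "det ?Q * det ?Q = 1"
    using arg_cong[OF eigenmatrix_orthogonal(1)[OF e], of det] by (simp add: det_mul)
  have "det (real_matrix A) * det ?Q = det ?Q * det (diagonal4 l)"
    using arg_cong[OF real_matrix_diagonalize[OF assms], of det] by (simp add: det_mul)
  then have "det (real_matrix A) * (det ?Q * det ?Q) = det (diagonal4 l) * (det ?Q * det ?Q)"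
    by (simp add: mult.assoc[symmetric])
  then have "det (real_matrix A) = det (diagonal4 l)"
    by (simp add: d)
  also have "\<dots> = (\<Prod>p\<in>(UNIV :: ('n \<times> 4) set). l (fst p))"
    by (subst det_diagonal) (auto simp: diagonal4_def)
  finally show ?thesis
    by (simp add: prod_fst_4)
qed

definition mpow :: "real^'m^'m \<Rightarrow> nat \<Rightarrow> real^'m^'m"
  where "mpow M k = (((**) M) ^^ k) (mat 1)"

lemma mpow_simps: "mpow M 0 = mat 1" "mpow M (Suc k) = M ** mpow M k"
  by (simp_all add: mpow_def)

lemma diagonal4_mult:
  fixes l m :: "'n::finite \<Rightarrow> real"
  shows "diagonal4 l ** diagonal4 m = diagonal4 (\<lambda>i. l i * m i)"
proof -
  have "(diagonal4 l ** diagonal4 m) $ p $ q = diagonal4 (\<lambda>i. l i * m i) $ p $ q" for p q :: "'n \<times> 4"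
  proof -
    have "(diagonal4 l ** diagonal4 m) $ p $ q = (\<Sum>k\<in>UNIV. diagonal4 l $ p $ k * diagonal4 m $ k $ q)"
      by (simp add: matrix_matrix_mult_def)
    also have "\<dots> = (\<Sum>k\<in>UNIV. if p = k then (if k = q then l (fst k) * m (fst k) else 0) else 0)"
      by (intro sum.cong) (auto simp: diagonal4_def)
    finally show ?thesis
      by (simp add: diagonal4_def)
  qed
  then show ?thesis
    by (simp add: vec_eq_iff)
qed

text \<open>The traces are polynomials in the entries of \<open>A\<close>, in contrast to the eigenvalues; they make the
  power sums of the eigenvalues accessible.\<close>

lemma trace_mpow_real_matrix:
  fixes A :: "quat^'n^'n"
  assumes A: "hyperhermitian A" and e: "eigensystem A l v"
  shows "trace (mpow (real_matrix A) k) = 4 * (\<Sum>i\<in>UNIV. l i ^ k)"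
proof -
  let ?Q = "eigenmatrix v"
  have pw: "mpow (real_matrix A) k ** ?Q = ?Q ** diagonal4 (\<lambda>i. l i ^ k)" for k
  proof (induction k)
    case 0
    have "diagonal4 (\<lambda>i::'n. 1) = mat 1"
      by (simp add: diagonal4_def mat_def)
    then show ?case by (simp add: mpow_simps)
  next
    case (Suc k)
    have d: "diagonal4 l ** diagonal4 (\<lambda>i. l i ^ k) = diagonal4 (\<lambda>i. l i ^ Suc k)"
      unfolding power_Suc by (rule diagonal4_mult)
    have "mpow (real_matrix A) (Suc k) ** ?Q = real_matrix A ** (mpow (real_matrix A) k ** ?Q)"
      by (simp add: mpow_simps matrix_mul_assoc)
    also have "\<dots> = (real_matrix A ** ?Q) ** diagonal4 (\<lambda>i. l i ^ k)"
      by (simp add: Suc matrix_mul_assoc)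
    also have "\<dots> = ?Q ** (diagonal4 l ** diagonal4 (\<lambda>i. l i ^ k))"
      by (simp add: real_matrix_diagonalize[OF assms] matrix_mul_assoc)
    finally show ?case by (simp only: d)
  qed
  have "mpow (real_matrix A) k = mpow (real_matrix A) k ** (?Q ** transpose ?Q)"
    by (simp add: eigenmatrix_orthogonal[OF e])
  also have "\<dots> = (?Q ** diagonal4 (\<lambda>i. l i ^ k)) ** transpose ?Q"
    by (simp add: matrix_mul_assoc pw)
  also have "trace \<dots> = trace (transpose ?Q ** (?Q ** diagonal4 (\<lambda>i. l i ^ k)))"
    by (rule trace_mul_sym)
  also have "\<dots> = trace (diagonal4 (\<lambda>i. l i ^ k))"
    by (simp add: matrix_mul_assoc eigenmatrix_orthogonal[OF e])
  also have "\<dots> = (\<Sum>p\<in>(UNIV :: ('n \<times> 4) set). l (fst p) ^ k)"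
    by (simp add: trace_def diagonal4_def)
  also have "\<dots> = 4 * (\<Sum>i\<in>UNIV. l i ^ k)"
    by (rule sum_fst_4)
  finally show ?thesis .
qed

lemma hyperhermitian_eq_0:
  assumes A: "hyperhermitian A" and e: "eigensystem A l v" and 0: "\<And>i. l i = 0"
  shows "A = 0"
proof -
  have "real_matrix A = real_matrix A ** (eigenmatrix v ** transpose (eigenmatrix v))"
    by (simp add: eigenmatrix_orthogonal[OF e])
  also have "\<dots> = (eigenmatrix v ** diagonal4 l) ** transpose (eigenmatrix v)"
    by (simp add: matrix_mul_assoc real_matrix_diagonalize[OF A e])
  also have "diagonal4 l = 0"
    by (simp add: diagonal4_def 0 vec_eq_iff)
  finally have R: "real_matrix A = 0"
    by (simp add: matrix_matrix_mult_def vec_eq_iff)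
  have "A $ i $ j = 0" for i j
  proof -
    have "(A *v real_basis (j, 1)) $ i = A $ i $ j"
      by (simp add: real_basis_def quat_unit_def matrix_vector_mult_def axis_def if_distrib cong: if_cong)
    then have "quat_unit a \<bullet> A $ i $ j = real_matrix A $ (i, a) $ (j, 1)" for a
      by (simp add: real_matrix_nth) (simp add: real_basis_def inner_axis')
    then have "quat_unit a \<bullet> A $ i $ j = 0" for a
      by (simp add: R)
    then have "A $ i $ j \<bullet> A $ i $ j = 0"
      using quat_unit_parseval[of "A $ i $ j" "A $ i $ j"] by simp
    then show ?thesis by simp
  qed
  then show ?thesis by (simp add: vec_eq_iff)
qed

section \<open>Elementary symmetric functions through power sums\<close>

text \<open>The second factor is the logarithmic derivative of the product: \<open>l / (1 + l x)\<close>, summed over all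
  \<open>l\<close> and expanded into geometric series. Comparing coefficients gives Newton's identities.\<close>

lemma fps_deriv_prod_linear:
  fixes l :: "'i \<Rightarrow> 'a::field_char_0"
  assumes "finite S"
  shows "fps_deriv (\<Prod>i\<in>S. 1 + fps_const (l i) * fps_X)
    = (\<Prod>i\<in>S. 1 + fps_const (l i) * fps_X) * Abs_fps (\<lambda>k. (-1) ^ k * (\<Sum>i\<in>S. l i ^ Suc k))"
  using assms
proof (induction S)
  case empty
  have "Abs_fps (\<lambda>k. 0) = (0 :: 'a fps)" by (simp add: fps_eq_iff)
  then show ?case by simp
next
  case (insert j S)
  define F where "F = (\<Prod>i\<in>S. 1 + fps_const (l i) * fps_X)"
  define G where "G = Abs_fps (\<lambda>k. (-1) ^ k * (\<Sum>i\<in>S. l i ^ Suc k))"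
  define g where "g = Abs_fps (\<lambda>k. (-1) ^ k * l j ^ Suc k)"
  define q where "q = 1 + fps_const (l j) * fps_X"
  have qg: "q * g = fps_const (l j)"
  proof (rule fps_ext)
    fix k show "fps_nth (q * g) k = fps_nth (fps_const (l j)) k"
      by (cases k) (simp_all add: q_def g_def distrib_right mult.assoc)
  qed
  have prod: "(\<Prod>i\<in>insert j S. 1 + fps_const (l i) * fps_X) = q * F"
    using insert.hyps by (simp add: q_def F_def)
  have sum: "Abs_fps (\<lambda>k. (-1) ^ k * (\<Sum>i\<in>insert j S. l i ^ Suc k)) = g + G"
    using insert.hyps by (simp add: g_def G_def fps_eq_iff distrib_left)
  have "fps_deriv (q * F) = fps_deriv q * F + q * fps_deriv F"
    by (simp add: algebra_simps)
  also have "fps_deriv q = q * g"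
    unfolding qg by (simp add: q_def)
  also have "fps_deriv F = F * G"
    using insert.IH by (simp add: F_def G_def)
  also have "q * g * F + q * (F * G) = (q * F) * (g + G)"
    by (simp only: ring_distribs mult_ac)
  finally show ?case
    unfolding prod sum .
qed

lemma newton_identity:
  fixes l :: "'i \<Rightarrow> real"
  assumes "finite S"
  defines "E \<equiv> \<Prod>i\<in>S. 1 + fps_const (l i) * fps_X"
  shows "fps_nth E (Suc k) = (\<Sum>j\<le>k. fps_nth E j * ((-1) ^ (k - j) * (\<Sum>i\<in>S. l i ^ Suc (k - j)))) / real (Suc k)"
proof -
  have "real (Suc k) * fps_nth E (Suc k) = fps_nth (fps_deriv E) k"
    by simp
  also have "\<dots> = (\<Sum>j\<le>k. fps_nth E j * ((-1) ^ (k - j) * (\<Sum>i\<in>S. l i ^ Suc (k - j))))"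
    unfolding E_def fps_deriv_prod_linear[OF assms(1)] by (simp add: fps_mult_nth atLeast0AtMost)
  finally show ?thesis by (simp add: field_simps)
qed

lemma fps_prod_linear_top:
  fixes l :: "'i \<Rightarrow> real"
  assumes "finite S"
  shows "fps_nth (\<Prod>i\<in>S. 1 + fps_const (l i) * fps_X) (card S) = (\<Prod>i\<in>S. l i)"
    and "k > card S \<Longrightarrow> fps_nth (\<Prod>i\<in>S. 1 + fps_const (l i) * fps_X) k = 0"
  using assms
proof (induction S arbitrary: k)
  case (insert j S)
  { case 1 show ?case using insert by (simp add: distrib_right mult.assoc) }
  { case 2 then show ?case using insert by (cases k) (simp_all add: distrib_right mult.assoc) }
qed auto

section \<open>The Moore polynomial\<close>

lemma real_polynomial_real_matrix: "real_polynomial_function (\<lambda>A. real_matrix A $ p $ q)"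
proof -
  have "linear (\<lambda>A. real_matrix A $ p $ q)"
    by (intro linearI)
       (simp_all add: real_matrix_def sesq_form_def qRe_sum distrib_left distrib_right sum.distrib
          sum_distrib_left del: quat_mult_sel(5))
  then show ?thesis
    by (auto simp: linear_conv_bounded_linear)
qed

lemma real_polynomial_mpow: "real_polynomial_function (\<lambda>A. mpow (real_matrix A) k $ p $ q)"
proof (induction k arbitrary: p q)
  case 0
  then show ?case by (simp add: mpow_simps real_polynomial_function.intros(2))
next
  case (Suc k)
  have "real_polynomial_function (\<lambda>A. \<Sum>r\<in>UNIV. real_matrix A $ p $ r * mpow (real_matrix A) k $ r $ q)"
    by (intro real_polynomial_function_sum real_polynomial_function.intros(4) real_polynomial_real_matrix Suc) auto
  then show ?case by (simp add: mpow_simps matrix_matrix_mult_def)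
qed

text \<open>Newton's identities express each elementary symmetric function of the eigenvalues through the
  earlier ones and the power sums, and the latter are a quarter of the traces of the powers of the real
  matrix.\<close>

lemma elementary_symmetric_polynomial:
  "\<exists>e. real_polynomial_function e \<and>
    (\<forall>(A :: quat^'n^'n) l v. hyperhermitian A \<longrightarrow> eigensystem A l v \<longrightarrow>
      e A = fps_nth (\<Prod>i\<in>UNIV. 1 + fps_const (l i) * fps_X) k)"
proof (induction k rule: less_induct)
  case (less k)
  show ?case
  proof (cases k)
    case 0
    have "fps_nth (\<Prod>i\<in>S. 1 + fps_const (l i) * fps_X) 0 = 1" for S and l :: "'n \<Rightarrow> real"
      by (induction S rule: infinite_finite_induct) auto
    then show ?thesis
      unfolding 0 by (intro exI[of _ "\<lambda>A. 1"]) (auto intro: real_polynomial_function.intros(2))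
  next
    case (Suc m)
    then have "\<forall>j\<in>{..m}. \<exists>e. real_polynomial_function e \<and>
      (\<forall>(A :: quat^'n^'n) l v. hyperhermitian A \<longrightarrow> eigensystem A l v \<longrightarrow>
        e A = fps_nth (\<Prod>i\<in>UNIV. 1 + fps_const (l i) * fps_X) j)"
      using less by auto
    from bchoice[OF this] obtain e where E: "\<forall>j\<in>{..m}. real_polynomial_function (e j) \<and>
      (\<forall>(A :: quat^'n^'n) l v. hyperhermitian A \<longrightarrow> eigensystem A l v \<longrightarrow>
        e j A = fps_nth (\<Prod>i\<in>UNIV. 1 + fps_const (l i) * fps_X) j)"
      by (rule exE)
    have e: "real_polynomial_function (e j)" if "j \<le> m" for j
      using E that by simp
    have e_eq: "e j A = fps_nth (\<Prod>i\<in>UNIV. 1 + fps_const (l i) * fps_X) j"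
      if "j \<le> m" "hyperhermitian A" "eigensystem A l v" for j l v and A :: "quat^'n^'n"
      using E that by blast
    define p where "p j A = trace (mpow (real_matrix A) j) / 4" for j and A :: "quat^'n^'n"
    have p: "real_polynomial_function (p j)" for j
      unfolding p_def trace_def
      by (intro real_polynomial_function_divide real_polynomial_function_sum real_polynomial_mpow) auto
    let ?f = "\<lambda>A. (\<Sum>j\<le>m. e j A * ((-1) ^ (m - j) * p (Suc (m - j)) A)) / real (Suc m)"
    have "real_polynomial_function ?f"
      by (intro real_polynomial_function_divide real_polynomial_function_sum real_polynomial_function.intros(4)
          real_polynomial_function.intros(2) p e) auto
    moreover have "?f A = fps_nth (\<Prod>i\<in>UNIV. 1 + fps_const (l i) * fps_X) k"
      if A: "hyperhermitian A" and l: "eigensystem A l v" for A l v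
      unfolding Suc newton_identity[OF finite]
      using e_eq[OF _ A l] trace_mpow_real_matrix[OF A l] by (simp add: p_def)
    ultimately show ?thesis by blast
  qed
qed

lemma hyperhermitian_mat_1: "hyperhermitian (mat 1)"
  by (auto simp: hyperhermitian_def mat_def quat_eq_iff)

lemma moore_polynomial_exists:
  obtains P where "moore_polynomial P"
    "\<And>(A :: quat^'n^'n) l v. hyperhermitian A \<Longrightarrow> eigensystem A l v \<Longrightarrow> P A = (\<Prod>i\<in>UNIV. l i)"
proof -
  obtain P where P: "real_polynomial_function P"
    and eq: "\<And>(A :: quat^'n^'n) l v. hyperhermitian A \<Longrightarrow> eigensystem A l v \<Longrightarrow> P A = (\<Prod>i\<in>UNIV. l i)"
    using elementary_symmetric_polynomial[where 'n = 'n, of "CARD('n)"] fps_prod_linear_top(1)[OF finite[of UNIV]]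
    by metis
  obtain l v where l: "eigensystem (mat 1 :: quat^'n^'n) l v"
    using eigensystem_exists[OF hyperhermitian_mat_1] .
  have "l i = 1" for i
    using l eigensystem_eigenvalue(2)[OF l, of i] unfolding eigensystem_def
    by (metis matrix_vector_mul_lid scaleR_cancel_right scaleR_one)
  then have "P (mat 1) = 1"
    using eq[OF hyperhermitian_mat_1 l] by simp
  then have "moore_polynomial P"
    using P eq det_real_matrix unfolding moore_polynomial_def by (metis eigensystem_exists)
  then show thesis using that eq by blast
qed

lemma real_polynomial_function_on_line:
  fixes P :: "'a::real_normed_vector \<Rightarrow> real"
  assumes "real_polynomial_function P"
  shows "\<exists>p. \<forall>t. P (X + t *\<^sub>R Y) = poly p t"
  using assms
proof (induction rule: real_polynomial_function.induct)
  case (linear f)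
  then interpret bounded_linear f .
  show ?case by (intro exI[of _ "[:f X, f Y:]"]) (simp add: add scale)
next
  case (const c)
  show ?case by (intro exI[of _ "[:c:]"]) simp
next
  case (add f g)
  then obtain p q where "\<forall>t. f (X + t *\<^sub>R Y) = poly p t" "\<forall>t. g (X + t *\<^sub>R Y) = poly q t" by blast
  then show ?case by (intro exI[of _ "p + q"]) simp
next
  case (mult f g)
  then obtain p q where "\<forall>t. f (X + t *\<^sub>R Y) = poly p t" "\<forall>t. g (X + t *\<^sub>R Y) = poly q t" by blast
  then show ?case by (intro exI[of _ "p * q"]) simp
qed

text \<open>In \<open>p\<^sup>4 - q\<^sup>4 = (p - q) (p + q) (p\<^sup>2 + q\<^sup>2)\<close> the last two factors do not vanish at \<open>0\<close>.\<close>

lemma real_poly_eq_of_fourth_power: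
  fixes p q :: "real poly"
  assumes "p ^ 4 = q ^ 4" and "poly p 0 = 1" "poly q 0 = 1"
  shows "p = q"
proof -
  have "(p - q) * (p + q) * (p\<^sup>2 + q\<^sup>2) = p ^ 4 - q ^ 4"
    by (simp add: power2_eq_square power4_eq_xxxx algebra_simps)
  then have "(p - q) * (p + q) * (p\<^sup>2 + q\<^sup>2) = 0"
    using assms by simp
  moreover have "poly (p + q) 0 \<noteq> 0" "poly (p\<^sup>2 + q\<^sup>2) 0 \<noteq> 0"
    using assms(2,3) by simp_all
  then have "p + q \<noteq> 0" "p\<^sup>2 + q\<^sup>2 \<noteq> 0"
    by (metis poly_0)+
  ultimately show ?thesis by (simp only: mult_eq_0_iff right_minus_eq simp_thms)
qed

text \<open>Fourth roots are compared along the line from the identity, where both take the value \<open>1\<close>, to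
  \<open>A\<close>.\<close>

lemma moore_polynomial_unique:
  assumes P: "moore_polynomial P" and Q: "moore_polynomial Q" and A: "hyperhermitian A"
  shows "P A = Q A"
proof -
  have herm: "hyperhermitian (mat 1 + t *\<^sub>R (A - mat 1))" for t
    using subspace_hyperhermitian A hyperhermitian_mat_1
    by (metis mem_Collect_eq subspace_add subspace_diff subspace_scale)
  obtain p q where p: "\<And>t. P (mat 1 + t *\<^sub>R (A - mat 1)) = poly p t"
    and q: "\<And>t. Q (mat 1 + t *\<^sub>R (A - mat 1)) = poly q t"
    using P Q real_polynomial_function_on_line unfolding moore_polynomial_def by metis
  have "poly (p ^ 4) t = poly (q ^ 4) t" for t
    using P Q herm[of t] p[of t] q[of t] unfolding moore_polynomial_def by (metis poly_power)
  then have "p ^ 4 = q ^ 4"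
    using poly_eq_poly_eq_iff by blast
  moreover have "poly p 0 = 1" "poly q 0 = 1"
    using P Q p[of 0] q[of 0] by (simp_all add: moore_polynomial_def)
  ultimately have "p = q"
    by (rule real_poly_eq_of_fourth_power)
  then show ?thesis
    using p[of 1] q[of 1] by simp
qed

lemma moore_det_eq:
  assumes "moore_polynomial P" "hyperhermitian A"
  shows "moore_det A = P A"
  unfolding moore_det_def
  by (rule the_equality) (use assms moore_polynomial_unique in blast)+

section \<open>Symmetric multilinear forms\<close>

definition perm_prod :: "nat \<Rightarrow> 'v list \<Rightarrow> ('v \<Rightarrow> 'k::real_field) list \<Rightarrow> 'k"
  where "perm_prod n us ws = (\<Sum>\<sigma> | \<sigma> permutes {..<n}. \<Prod>i<n. (ws ! i) (us ! \<sigma> i))"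

text \<open>A list of pairs \<open>(c, us)\<close> stands for the polynomial \<open>\<Sum> c * \<Prod> us\<close> in the symbols occurring in
  the lists \<open>us\<close>, which are meant to have length \<open>n\<close>. A point assigns a number to each symbol, and
  \<open>polar\<close> is the symmetric multilinear form in \<open>n\<close> points whose diagonal is that polynomial. Real and
  complex points are treated alike: complexifying a real form amounts to admitting complex points.\<close>

definition polar :: "(real \<times> 'v list) list \<Rightarrow> nat \<Rightarrow> ('v \<Rightarrow> 'k::real_field) list \<Rightarrow> 'k"
  where "polar F n ws = (\<Sum>(c, us)\<leftarrow>F. of_real c * perm_prod n us ws) / fact n"

lemma perm_prod_linear:
  "perm_prod (Suc m) us ((\<lambda>u. a u + s * b u) # ws)
    = perm_prod (Suc m) us (a # ws) + s * perm_prod (Suc m) us (b # ws)"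
  unfolding perm_prod_def
  by (simp add: prod.lessThan_Suc_shift sum.distrib sum_distrib_left algebra_simps
           del: prod.lessThan_Suc)

lemma polar_linear:
  "polar F (Suc m) ((\<lambda>u. a u + s * b u) # ws)
    = polar F (Suc m) (a # ws) + s * polar F (Suc m) (b # ws)"
  by (induction F) (auto simp: polar_def perm_prod_linear field_simps simp del: fact_Suc)

lemma perm_prod_permute:
  assumes "mset xs = mset ys" "length ys = n"
  shows "perm_prod n us xs = perm_prod n us ys"
proof -
  obtain p where p: "p permutes {..<n}" "permute_list p ys = xs"
    using mset_eq_permutation[OF assms(1)] assms(2) by blast
  have "perm_prod n us xs = (\<Sum>\<sigma> | \<sigma> permutes {..<n}. \<Prod>i<n. (ys ! p i) (us ! \<sigma> i))"
    unfolding perm_prod_def p(2)[symmetric]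
    by (intro sum.cong prod.cong refl) (use p assms in \<open>auto simp: permute_list_nth\<close>)
  also have "\<dots> = (\<Sum>\<sigma> | \<sigma> permutes {..<n}. \<Prod>i<n. (ys ! p i) (us ! (\<sigma> \<circ> p) i))"
    by (rule sum_permutations_compose_right[OF p(1)])
  also have "\<dots> = (\<Sum>\<sigma> | \<sigma> permutes {..<n}. \<Prod>i<n. (ys ! i) (us ! \<sigma> i))"
  proof (intro sum.cong refl)
    fix \<sigma>
    show "(\<Prod>i<n. (ys ! p i) (us ! (\<sigma> \<circ> p) i)) = (\<Prod>i<n. (ys ! i) (us ! \<sigma> i))"
      using prod.permute[OF p(1), of "\<lambda>i. (ys ! i) (us ! \<sigma> i)"] by (simp add: o_def)
  qed
  finally show ?thesis
    by (simp add: perm_prod_def)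
qed

lemma polar_mset_cong:
  assumes "mset xs = mset ys" "length ys = n"
  shows "polar F n xs = polar F n ys"
  unfolding polar_def using perm_prod_permute[OF assms] by simp

lemma perm_prod_replicate: "perm_prod n us (replicate n w) = fact n * (\<Prod>i<n. w (us ! i))"
proof -
  have "perm_prod n us (replicate n w) = (\<Sum>\<sigma> | \<sigma> permutes {..<n}. \<Prod>i<n. w (us ! i))"
    unfolding perm_prod_def
  proof (intro sum.cong refl)
    fix \<sigma> assume "\<sigma> \<in> {\<sigma>. \<sigma> permutes {..<n}}"
    then have "(\<Prod>i<n. w (us ! i)) = (\<Prod>i<n. w (us ! \<sigma> i))"
      using prod.permute[of \<sigma> "{..<n}" "\<lambda>i. w (us ! i)"] by (simp add: o_def)
    then show "(\<Prod>i<n. (replicate n w ! i) (us ! \<sigma> i)) = (\<Prod>i<n. w (us ! i))"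
      by simp
  qed
  then show ?thesis
    by (simp add: card_permutations)
qed

lemma polar_replicate:
  "polar F n (replicate n w) = (\<Sum>(c, us)\<leftarrow>F. of_real c * (\<Prod>i<n. w (us ! i)))"
proof -
  have "(\<Sum>(c, us)\<leftarrow>F. of_real c * perm_prod n us (replicate n w))
      = fact n * (\<Sum>(c, us)\<leftarrow>F. of_real c * (\<Prod>i<n. w (us ! i)))"
    by (induction F) (auto simp: perm_prod_replicate algebra_simps)
  then show ?thesis
    by (simp add: polar_def)
qed

lemma of_real_sum_list_map: "of_real (\<Sum>x\<leftarrow>xs. f x) = (\<Sum>x\<leftarrow>xs. of_real (f x))"
  by (induction xs) auto

lemma polar_of_real:
  assumes "length ws = n"
  shows "polar F n (map (\<lambda>w u. of_real (w u)) ws) = (of_real (polar F n ws) :: 'k::real_field)"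
proof -
  have "perm_prod n us (map (\<lambda>w u. of_real (w u)) ws) = (of_real (perm_prod n us ws) :: 'k)" for us
    unfolding perm_prod_def of_real_sum of_real_prod
    by (intro sum.cong prod.cong refl) (use assms in auto)
  then show ?thesis
    by (simp add: polar_def of_real_sum_list_map case_prod_unfold o_def)
qed

lemma polar_binomial:
  assumes "length R + m = n"
  shows "polar F n (replicate m (\<lambda>u. w u + s * a u) @ R)
    = (\<Sum>j\<le>m. of_nat (m choose j) * polar F n (replicate j a @ replicate (m - j) w @ R) * s ^ j)"
  using assms
proof (induction m arbitrary: R)
  case 0
  then show ?case by simp
next
  case (Suc m)
  let ?D = "polar F n"
  let ?ws = "\<lambda>u. w u + s * a u"
  obtain n' where n': "n = Suc n'"
    using Suc.prems by (cases n) auto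
  have *: "?D (replicate j a @ replicate (m - j) w @ b # R) = ?D (b # replicate j a @ replicate (m - j) w @ R)"
    if "j \<le> m" for j b
    by (rule polar_mset_cong) (use Suc.prems that in auto)
  have a: "?D (replicate j a @ replicate (m - j) w @ a # R) = ?D (replicate (Suc j) a @ replicate (Suc m - Suc j) w @ R)"
    if "j \<le> m" for j
    by (rule polar_mset_cong) (use Suc.prems that in auto)
  have w: "?D (replicate j a @ replicate (m - j) w @ w # R) = ?D (replicate j a @ replicate (Suc m - j) w @ R)"
    if "j \<le> m" for j
    by (rule polar_mset_cong) (use Suc.prems that in \<open>auto simp: Suc_diff_le\<close>)
  let ?t = "\<lambda>j. ?D (replicate j a @ replicate (Suc m - j) w @ R) * s ^ j"
  have "?D (replicate (Suc m) ?ws @ R) = ?D (replicate m ?ws @ ?ws # R)"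
    by (rule polar_mset_cong) (use Suc.prems in auto)
  also have "\<dots> = (\<Sum>j\<le>m. of_nat (m choose j) * ?D (replicate j a @ replicate (m - j) w @ ?ws # R) * s ^ j)"
    by (rule Suc.IH) (use Suc.prems in auto)
  also have "\<dots> = (\<Sum>j\<le>m. of_nat (m choose j) * (?t j + ?t (Suc j)))"
  proof (intro sum.cong refl)
    fix j assume "j \<in> {..m}"
    then have j: "j \<le> m" by simp
    have "?D (replicate j a @ replicate (m - j) w @ ?ws # R)
      = ?D (replicate j a @ replicate (m - j) w @ w # R) + s * ?D (replicate j a @ replicate (m - j) w @ a # R)"
      unfolding *[OF j] unfolding n' by (rule polar_linear)
    then show "of_nat (m choose j) * ?D (replicate j a @ replicate (m - j) w @ ?ws # R) * s ^ j
      = of_nat (m choose j) * (?t j + ?t (Suc j))"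
      unfolding a[OF j] w[OF j] by (simp add: algebra_simps)
  qed
  also have "\<dots> = (\<Sum>j\<le>m. of_nat (m choose j) * ?t j) + (\<Sum>j\<le>m. of_nat (m choose j) * ?t (Suc j))"
    by (simp add: sum.distrib distrib_left)
  also have "(\<Sum>j\<le>m. of_nat (m choose j) * ?t j) = (\<Sum>j\<le>Suc m. of_nat (m choose j) * ?t j)"
    by simp
  also have "\<dots> = ?t 0 + (\<Sum>j\<le>m. of_nat (m choose Suc j) * ?t (Suc j))"
    by (subst sum.atMost_Suc_shift) simp
  also have "?t 0 + (\<Sum>j\<le>m. of_nat (m choose Suc j) * ?t (Suc j)) + (\<Sum>j\<le>m. of_nat (m choose j) * ?t (Suc j))
    = ?t 0 + (\<Sum>j\<le>m. of_nat (Suc m choose Suc j) * ?t (Suc j))"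
    by (simp add: sum.distrib[symmetric] algebra_simps)
  also have "\<dots> = (\<Sum>j\<le>Suc m. of_nat (Suc m choose j) * ?t j)"
    by (subst sum.atMost_Suc_shift) simp
  finally show ?case
    by (simp add: mult.assoc)
qed

text \<open>The case of the theorem of Gauss and Lucas that is used below. If the zeros \<open>z\<close> of \<open>h\<close> lie in the
  open lower half-plane, then \<open>h' 0 / h 0 = - (\<Sum> 1 / z)\<close> has negative imaginary part, as each
  \<open>1 / z\<close> has positive imaginary part.\<close>

lemma upper_half_plane_deriv_nonzero:
  fixes h :: "complex poly"
  assumes "degree h > 0" "\<And>s. Im s \<ge> 0 \<Longrightarrow> poly h s \<noteq> 0"
  shows "coeff h 1 \<noteq> 0"
proof -
  \<comment> \<open>Splitting off one linear factor adds \<open>- 1 / z\<close> to the quotient of the coefficients.\<close>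
  have "Im (coeff h 1 / coeff h 0) < 0 \<or> degree h = 0" "coeff h 0 \<noteq> 0" if "\<And>s. Im s \<ge> 0 \<Longrightarrow> poly h s \<noteq> 0"
    for h :: "complex poly"
    using that
  proof (induction "degree h" arbitrary: h)
    case 0
    { case 1 then show ?case using 0 by simp }
    { case 2 then show ?case using 0 "2"[of 0] by (simp add: poly_0_coeff_0) }
  next
    case (Suc d)
    have nz: "coeff h 0 \<noteq> 0" if "\<And>s. Im s \<ge> 0 \<Longrightarrow> poly h s \<noteq> 0"
      using that[of 0] by (simp add: poly_0_coeff_0)
    { case 2 then show ?case using nz by simp }
    { case 1
      have "\<not> (\<exists>a l. a \<noteq> 0 \<and> l = 0 \<and> h = pCons a l)"
        using Suc.hyps(3) by auto
      then obtain z where z: "poly h z = 0"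
        using fundamental_theorem_of_algebra_alt by blast
      then have imz: "Im z < 0"
        using 1 by (meson not_le_imp_less)
      obtain q where q: "h = [:- z, 1:] * q"
        using z poly_eq_0_iff_dvd by (metis dvdE)
      have "q \<noteq> 0" using q Suc.hyps(3) by auto
      then have "degree h = degree [:- z, 1:] + degree q"
        unfolding q by (intro degree_mult_eq) auto
      then have dq: "d = degree q"
        using Suc.hyps(3) by simp
      have nq: "\<And>s. Im s \<ge> 0 \<Longrightarrow> poly q s \<noteq> 0"
        using 1 q by auto
      have c0: "coeff h 0 = - z * coeff q 0" and c1: "coeff h 1 = - z * coeff q 1 + coeff q 0"
        unfolding q by (simp_all add: coeff_pCons algebra_simps)
      have q0: "coeff q 0 \<noteq> 0" using Suc.hyps(2)[OF dq] nq by blast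
      have "z \<noteq> 0" using imz by auto
      then have *: "coeff h 1 / coeff h 0 = coeff q 1 / coeff q 0 - 1 / z"
        using c0 c1 q0 by (simp add: field_simps)
      have "Im (coeff q 1 / coeff q 0) \<le> 0"
        using Suc.hyps(1)[OF dq] nq by (cases "degree q = 0") (force simp: coeff_eq_0)+
      moreover have "Im (1 / z) > 0"
        using imz \<open>z \<noteq> 0\<close> by (simp add: Im_divide complex_neq_0 divide_neg_pos)
      ultimately have "Im (coeff h 1 / coeff h 0) < 0"
        unfolding * by simp
      then show ?case ..
    }
  qed
  from this(1)[OF assms(2)] show ?thesis using assms(1) by auto
qed


lemma polar_scale:
  assumes "length R + k = n"
  shows "polar F n (replicate k (\<lambda>u. s * a u) @ R) = s ^ k * polar F n (replicate k a @ R)"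
  using assms
proof (induction k arbitrary: R)
  case (Suc k)
  obtain m where n: "n = Suc m" using Suc.prems by (cases n) auto
  have z: "polar F (Suc m) ((\<lambda>u. 0) # R') = 0" for R'
    using polar_linear[of F m "\<lambda>u. 0" "-1" "\<lambda>u. 0" R'] by simp
  have 1: "polar F n ((\<lambda>u. s * a u) # R') = s * polar F n (a # R')" for R'
    unfolding n using polar_linear[of F m "\<lambda>u. 0" s a R'] by (simp add: z)
  have "polar F n (replicate (Suc k) (\<lambda>u. s * a u) @ R)
      = s * polar F n (a # replicate k (\<lambda>u. s * a u) @ R)"
    by (simp add: 1)
  also have "polar F n (a # replicate k (\<lambda>u. s * a u) @ R)
      = polar F n (replicate k (\<lambda>u. s * a u) @ a # R)"
    by (rule polar_mset_cong) (use Suc.prems in auto)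
  also have "\<dots> = s ^ k * polar F n (replicate k a @ a # R)"
    by (rule Suc.IH) (use Suc.prems in auto)
  also have "polar F n (replicate k a @ a # R) = polar F n (replicate (Suc k) a @ R)"
    by (rule polar_mset_cong) (use Suc.prems in auto)
  finally show ?case by (simp add: mult.assoc)
qed simp

section \<open>Hyperbolic forms on a cone\<close>

text \<open>The point \<open>X + iY\<close> of the complexified space, where a vector \<open>u\<close> is the symbol for the linear
  functional of taking the inner product with \<open>u\<close>.\<close>

definition cpoint :: "'a::euclidean_space \<Rightarrow> 'a \<Rightarrow> 'a \<Rightarrow> complex"
  where "cpoint X Y = (\<lambda>u. Complex (X \<bullet> u) (Y \<bullet> u))"

lemma cpoint_shift:
  "(\<lambda>u. cpoint X Y u + s * cpoint A 0 u) = cpoint (X + Re s *\<^sub>R A) (Y + Im s *\<^sub>R A)"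
  by (auto simp: cpoint_def complex_eq_iff inner_add_left)

text \<open>A homogeneous polynomial of degree \<open>n\<close> on \<open>V\<close> that does not vanish at \<open>X + iY\<close> for \<open>Y\<close> in the cone
  \<open>K\<close>. Equivalently, its restrictions to lines with direction in \<open>K\<close> are real-rooted.
  The assumption \<open>K_open\<close> says that \<open>K\<close> is open in \<open>V\<close>, tested along rays.\<close>

locale hyperbolic_form =
  fixes F :: "(real \<times> 'a::euclidean_space list) list" and n :: nat and V K :: "'a set"
  assumes V: "subspace V" and K_subset: "K \<subseteq> V"
    and K_add: "\<And>X Y. X \<in> K \<Longrightarrow> Y \<in> K \<Longrightarrow> X + Y \<in> K"
    and K_scale: "\<And>c X. c > 0 \<Longrightarrow> X \<in> K \<Longrightarrow> c *\<^sub>R X \<in> K"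
    and K_open: "\<And>A X. A \<in> K \<Longrightarrow> X \<in> V \<Longrightarrow> \<exists>e>0. A + e *\<^sub>R X \<in> K"
    and nonvanishing: "\<And>X Y. X \<in> V \<Longrightarrow> Y \<in> K \<Longrightarrow> polar F n (replicate n (cpoint X Y)) \<noteq> 0"
    and positive: "\<And>Y. Y \<in> K \<Longrightarrow> polar F n (replicate n (inner Y)) > 0"
begin

definition D :: "'a list \<Rightarrow> real"
  where "D Xs = polar F n (map inner Xs)"

abbreviation DC :: "('a \<Rightarrow> complex) list \<Rightarrow> complex"
  where "DC ws \<equiv> polar F n ws"

abbreviation rc :: "'a \<Rightarrow> 'a \<Rightarrow> complex"
  where "rc A \<equiv> cpoint A 0"

lemma DC_real:
  assumes "length Xs = n"
  shows "DC (map rc Xs) = of_real (D Xs)"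
proof -
  have "map rc Xs = map (\<lambda>w u. of_real (w u)) (map inner Xs)"
    by (simp add: cpoint_def complex_of_real_def)
  then have "DC (map rc Xs) = DC (map (\<lambda>w u. of_real (w u)) (map inner Xs))"
    by (simp only:)
  then show ?thesis
    using polar_of_real[of "map inner Xs" n F, where 'k = complex] assms by (simp add: D_def del: map_map)
qed

lemma D_mset_cong: "mset Xs = mset Ys \<Longrightarrow> length Ys = n \<Longrightarrow> D Xs = D Ys"
  unfolding D_def by (rule polar_mset_cong) auto

lemma D_linear:
  assumes "n > 0"
  shows "D ((X + s *\<^sub>R Y) # Zs) = D (X # Zs) + s * D (Y # Zs)"
proof -
  obtain m where n: "n = Suc m" using assms by (cases n) auto
  have "inner (X + s *\<^sub>R Y) = (\<lambda>u. inner X u + s * inner Y u)"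
    by (simp add: fun_eq_iff inner_add_left)
  then show ?thesis
    unfolding D_def by (simp add: n polar_linear)
qed

lemma D_binomial:
  assumes "length R + m = n"
  shows "D (replicate m (X + s *\<^sub>R A) @ R)
    = (\<Sum>j\<le>m. of_nat (m choose j) * D (replicate j A @ replicate (m - j) X @ R) * s ^ j)"
proof -
  have "inner (X + s *\<^sub>R A) = (\<lambda>u. inner X u + s * inner A u)"
    by (simp add: fun_eq_iff inner_add_left)
  then show ?thesis
    unfolding D_def using polar_binomial[of "map inner R" m n F "inner X" s "inner A"] assms
    by simp
qed

lemma K_shift: "Y \<in> K \<Longrightarrow> A \<in> K \<Longrightarrow> s \<ge> 0 \<Longrightarrow> Y + s *\<^sub>R A \<in> K"
  using K_add K_scale by (cases "s = 0") auto

text \<open>The derivative in a direction \<open>A\<close> of the cone inherits both properties of the form, and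
  differentiating replaces one of the equal arguments by \<open>A\<close>. Nonvanishing: the polynomial
  \<open>s \<mapsto> D ((X + iY + sA)\<^sup>k\<^sup>+\<^sup>1, R)\<close> has no zero with \<open>Im s \<ge> 0\<close>, because then the imaginary part
  \<open>Y + (Im s) A\<close> is still in the cone; so its derivative at \<open>0\<close> is nonzero. Positivity: a
  continuous function without zeros on the segment from \<open>A\<close> to \<open>Y\<close> keeps the sign that it has
  at \<open>A\<close>.\<close>

lemma hyperbolic_derivative:
  assumes "set R \<subseteq> K" "length R + k = n"
  shows "X \<in> V \<Longrightarrow> Y \<in> K \<Longrightarrow> DC (replicate k (cpoint X Y) @ map rc R) \<noteq> 0"
    and "Y \<in> K \<Longrightarrow> D (replicate k Y @ R) > 0"
  using assms
proof (induction R arbitrary: k X Y)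
  case Nil
  { case 1 then show ?case using nonvanishing by simp }
  { case 2 then show ?case using positive by (simp add: D_def) }
next
  case (Cons A R)
  have nonzero: "DC (replicate k (cpoint X Y) @ map rc (A # R)) \<noteq> 0"
    if X: "X \<in> V" and Y: "Y \<in> K" and K: "set (A # R) \<subseteq> K" and len: "length (A # R) + k = n" for X Y k
  proof -
    define c where "c = (\<lambda>j. of_nat (Suc k choose j) *
      DC (replicate j (rc A) @ replicate (Suc k - j) (cpoint X Y) @ map rc R))"
    define h where "h = (\<Sum>j\<le>Suc k. monom (c j) j)"
    have coeff_h: "coeff h j = (if j \<le> Suc k then c j else 0)" for j
      by (simp add: h_def coeff_sum del: sum.atMost_Suc)
    have poly_h: "poly h s = DC (replicate (Suc k) (\<lambda>u. cpoint X Y u + s * rc A u) @ map rc R)" for s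
      by (subst polar_binomial) (use len in \<open>auto simp: h_def c_def poly_sum poly_monom simp del: sum.atMost_Suc\<close>)
    have "poly h s \<noteq> 0" if "Im s \<ge> 0" for s
      unfolding poly_h cpoint_shift
    proof (rule Cons.IH(1))
      show "X + Re s *\<^sub>R A \<in> V"
        using X K K_subset V by (intro subspace_add subspace_scale) auto
      show "Y + Im s *\<^sub>R A \<in> K"
        using K_shift[OF Y _ that] K by auto
    qed (use K len in auto)
    \<comment> \<open>The leading coefficient is the value of the form at \<open>A\<close>, so \<open>h\<close> is not constant.\<close>
    moreover have "coeff h (Suc k) = of_real (D (replicate (Suc k) A @ R))"
      using DC_real[of "replicate (Suc k) A @ R"] len by (simp add: coeff_h c_def)
    then have "coeff h (Suc k) \<noteq> 0"
      using Cons.IH(2)[of A "Suc k"] K len by simp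
    then have "degree h > 0"
      using le_degree by fastforce
    ultimately have "coeff h 1 \<noteq> 0"
      by (intro upper_half_plane_deriv_nonzero)
    then have "DC (rc A # replicate k (cpoint X Y) @ map rc R) \<noteq> 0"
      by (simp add: coeff_h c_def)
    also have "DC (rc A # replicate k (cpoint X Y) @ map rc R) = DC (replicate k (cpoint X Y) @ map rc (A # R))"
      by (rule polar_mset_cong) (use len in auto)
    finally show ?thesis .
  qed
  { case 1 then show ?case using nonzero by blast }
  { case (2 k Y)
    then have YK: "Y \<in> K" and AK: "A \<in> K" and RK: "set R \<subseteq> K" and len: "length R + Suc k = n" by auto
    define g where "g t = D (replicate k (A + t *\<^sub>R (Y - A)) @ A # R)" for t
    have g_sum: "g = (\<lambda>t. \<Sum>j\<le>k. of_nat (k choose j) * D (replicate j (Y - A) @ replicate (k - j) A @ A # R) * t ^ j)"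
      unfolding g_def by (rule ext, rule D_binomial) (use len in auto)
    have "continuous_on {0..1} g"
      unfolding g_sum by (intro continuous_intros)
    moreover have "g t \<noteq> 0" if "t \<in> {0..1}" for t
    proof
      assume gt: "g t = 0"
      define Z where "Z = A + t *\<^sub>R (Y - A)"
      have "Z = (1 - t) *\<^sub>R A + t *\<^sub>R Y"
        by (simp add: Z_def algebra_simps)
      then have Z: "Z \<in> K"
        using that K_shift[of Y A 0] AK YK K_add K_scale
        by (cases "t = 0"; cases "t = 1") auto
      \<comment> \<open>At the purely imaginary point the value differs from the real one by a power of \<open>\<i>\<close> only.\<close>
      have "cpoint 0 Z = (\<lambda>u. \<i> * rc Z u)"
        by (auto simp: cpoint_def complex_eq_iff)
      then have "DC (replicate k (cpoint 0 Z) @ map rc (A # R)) = \<i> ^ k * DC (map rc (replicate k Z @ A # R))"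
        using polar_scale[of "map rc (A # R)" k n F \<i> "rc Z"] len by simp
      also have "\<dots> = 0"
        using DC_real[of "replicate k Z @ A # R"] len gt unfolding g_def Z_def by simp
      finally show False
        using nonzero[of 0 Z] V Z AK RK len by (simp add: subspace_0)
    qed
    moreover have "g 0 > 0"
    proof -
      have "g 0 = D (replicate (Suc k) A @ R)"
        unfolding g_def by (rule D_mset_cong) (use len in auto)
      then show ?thesis
        using Cons.IH(2)[of A "Suc k"] AK RK len by simp
    qed
    ultimately have "g 1 > 0"
      using IVT2'[of g 1 0 0] by (metis atLeastAtMost_iff not_le_imp_less zero_le_one less_le)
    then show ?case by (simp add: g_def)
  }
qed

lemma D_pos:
  assumes "set R \<subseteq> K" "length R = n" "n > 0"
  shows "D R > 0"
proof -
  obtain A R' where "R = A # R'" using assms by (cases R) auto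
  then show ?thesis
    using hyperbolic_derivative(2)[of R 0 A] assms by simp
qed

text \<open>If \<open>D (X # X # R)\<close> were positive, then \<open>t > 0\<close> could be chosen with \<open>D (X # X # R) = t\<^sup>2 * D (Y # Y # R)\<close>. As
  the mixed term vanishes, \<open>X + itY\<close> would be a zero of the quadratic form, although its imaginary part
  is in the cone.\<close>

lemma D_hodge:
  assumes R: "set R \<subseteq> K" "length R + 2 = n" and X: "X \<in> V" and Y: "Y \<in> K"
    and orth: "D (X # Y # R) = 0"
  shows "D (X # X # R) \<le> 0"
proof (rule ccontr)
  assume "\<not> ?thesis"
  then have a: "D (X # X # R) > 0" by simp
  have b: "D (Y # Y # R) > 0"
    using hyperbolic_derivative(2)[of R 2 Y] R Y by (simp add: numeral_2_eq_2)
  define t where "t = sqrt (D (X # X # R) / D (Y # Y # R))"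
  have t: "t > 0" "t\<^sup>2 * D (Y # Y # R) = D (X # X # R)"
    using a b by (auto simp: t_def)
  obtain m where n: "n = Suc m" using R by (cases n) auto
  have lin: "DC ((\<lambda>u. rc X u + s * rc Y u) # ws) = DC (rc X # ws) + s * DC (rc Y # ws)" for s ws
    unfolding n by (rule polar_linear)
  have swap: "DC (v # w # map rc R) = DC (w # v # map rc R)" for v w
    by (rule polar_mset_cong) (use R in auto)
  have w: "cpoint X (t *\<^sub>R Y) = (\<lambda>u. rc X u + (\<i> * t) * rc Y u)"
    by (auto simp: cpoint_def complex_eq_iff)
  let ?w = "cpoint X (t *\<^sub>R Y)"
  have "DC (?w # ?w # map rc R) = DC (rc X # ?w # map rc R) + \<i> * t * DC (rc Y # ?w # map rc R)"
    by (subst (1) w) (rule lin)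
  also have "DC (rc X # ?w # map rc R) = DC (rc X # rc X # map rc R) + \<i> * t * DC (rc X # rc Y # map rc R)"
    by (subst swap, subst w, subst lin) (simp add: swap)
  also have "DC (rc Y # ?w # map rc R) = DC (rc X # rc Y # map rc R) + \<i> * t * DC (rc Y # rc Y # map rc R)"
    by (subst swap, subst w, subst lin) (simp add: swap)
  also have "DC (rc X # rc X # map rc R) = D (X # X # R)"
    using DC_real[of "X # X # R"] R by simp
  also have "DC (rc X # rc Y # map rc R) = 0"
    using DC_real[of "X # Y # R"] R orth by simp
  also have "DC (rc Y # rc Y # map rc R) = D (Y # Y # R)"
    using DC_real[of "Y # Y # R"] R by simp
  also have "D (X # X # R) + \<i> * t * 0 + \<i> * t * (0 + \<i> * t * D (Y # Y # R)) = of_real (D (X # X # R) - t\<^sup>2 * D (Y # Y # R))"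
    by (simp add: complex_eq_iff power2_eq_square algebra_simps)
  finally have "DC (?w # ?w # map rc R) = 0"
    using t by simp
  then show False
    using hyperbolic_derivative(1)[of R 2 X "t *\<^sub>R Y"] R X K_scale[OF t(1) Y]
    by (simp add: numeral_2_eq_2)
qed

text \<open>Let \<open>X\<close> be in the radical of \<open>D (_ # _ # A # R)\<close>. For \<open>W\<close> in the cone, \<open>X\<close> is orthogonal to \<open>A\<close>
  with respect to \<open>D (_ # _ # W # R)\<close>, so that \<open>D (X # X # W # R) \<le> 0\<close>. This linear function of \<open>W\<close> is zero at the
  interior point \<open>A\<close> of the cone, hence it is zero everywhere. So \<open>X\<close> is a null vector of
  \<open>D (_ # _ # Z # R)\<close> in the complement of \<open>A\<close>, where that form is negative semidefinite; it is
  therefore in the radical of the form on this complement, and being orthogonal to \<open>A\<close> as well, in the radical of the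
  whole form.\<close>

lemma radical_change_one:
  assumes R: "set R \<subseteq> K" "length R + 3 = n" and A: "A \<in> K" and Z: "Z \<in> K"
    and X: "X \<in> V" and rad: "\<And>Y. Y \<in> V \<Longrightarrow> D (X # Y # A # R) = 0" and Y: "Y \<in> V"
  shows "D (X # Y # Z # R) = 0"
proof -
  have n: "n > 0" using R by simp
  note lin = D_linear[OF n]
  have perm: "D (x # y # z # R) = D (y # x # z # R)" "D (x # y # z # R) = D (z # x # y # R)" for x y z
    by (rule D_mset_cong; use R in auto)+
  have XA: "D (X # A # W # R) = 0" if "W \<in> V" for W
    using rad[OF that] perm by metis
  have sub: "A \<in> V" "Z \<in> V" using A Z K_subset by auto
  have XXle: "D (X # X # W # R) \<le> 0" if "W \<in> K" for W
    by (rule D_hodge[where Y = A]) (use that R X A XA K_subset in auto)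
  have lin3: "D (X # X # (W + s *\<^sub>R W') # R) = D (X # X # W # R) + s * D (X # X # W' # R)" for W s W'
    unfolding perm(2)[of X X] lin ..
  have half: "D (X # X # W # R) \<le> 0" if W: "W \<in> V" for W
  proof -
    obtain e where e: "e > 0" "A + e *\<^sub>R W \<in> K"
      using K_open[OF A W] by blast
    have "e * D (X # X # W # R) \<le> 0"
      using XXle[OF e(2)] lin3[of A e W] rad[OF X] by simp
    then show ?thesis using e(1) by (simp add: mult_le_0_iff)
  qed
  have XX: "D (X # X # Z # R) = 0"
    using half[of Z] half[of "0 + (-1) *\<^sub>R Z"] lin3[of 0 "-1" Z] lin3[of 0 "-1" 0] sub V
    by (simp add: subspace_neg)
  \<comment> \<open>\<open>Y'\<close> is the projection of \<open>Y\<close> to the complement of \<open>A\<close>.\<close>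
  define a where "a = D (Y # A # Z # R) / D (A # A # Z # R)"
  have AA: "D (A # A # Z # R) > 0"
    by (rule D_pos) (use R A Z in auto)
  define Y' where "Y' = Y + (- a) *\<^sub>R A"
  have Y'V: "Y' \<in> V" unfolding Y'_def using V Y sub by (intro subspace_add subspace_scale)
  have Y'A: "D (Y' # A # Z # R) = 0"
    unfolding Y'_def lin using AA by (simp add: a_def)
  have "2 * t * D (X # Y' # Z # R) + t\<^sup>2 * D (Y' # Y' # Z # R) \<le> 0" for t
  proof -
    let ?U = "X + t *\<^sub>R Y'"
    have "D (?U # A # Z # R) = 0"
      unfolding lin by (simp add: Y'A XA sub)
    moreover have "?U \<in> V" using V X Y'V by (intro subspace_add subspace_scale)
    ultimately have "D (?U # ?U # Z # R) \<le> 0"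
      using R Z A by (intro D_hodge[where Y = A]) auto
    moreover have "D (?U # ?U # Z # R) = D (X # ?U # Z # R) + t * D (Y' # ?U # Z # R)"
      by (rule lin)
    moreover have "D (X # ?U # Z # R) = D (X # X # Z # R) + t * D (X # Y' # Z # R)"
      "D (Y' # ?U # Z # R) = D (X # Y' # Z # R) + t * D (Y' # Y' # Z # R)"
      by (subst perm(1), subst lin, simp add: perm(1))+
    ultimately show ?thesis
      using XX by (simp add: algebra_simps power2_eq_square)
  qed
  then have XY': "D (X # Y' # Z # R) = 0"
    by (rule linear_dominates_quadratic)
  have "D (Y' # X # Z # R) = D (Y # X # Z # R) + (- a) * D (A # X # Z # R)"
    unfolding Y'_def by (rule lin)
  then show ?thesis
    using XY' XA[OF sub(2)] perm(1) by (metis add_cancel_left_right mult_zero_right add.commute)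
qed

lemma radical_independent:
  assumes "length R = length S" "set (R @ S @ T) \<subseteq> K" "length (R @ T) + 2 = n"
    and X: "X \<in> V" and rad: "\<And>Y. Y \<in> V \<Longrightarrow> D (X # Y # R @ T) = 0" and Y: "Y \<in> V"
  shows "D (X # Y # S @ T) = 0"
  using assms(1-3) rad Y
proof (induction R S arbitrary: T Y rule: list_induct2)
  case (Cons A R B S)
  have "D (X # Y # B # R @ T) = 0" if "Y \<in> V" for Y
    by (rule radical_change_one[where A = A]) (use Cons.prems X that in auto)
  moreover have "D (X # Y # R @ B # T) = D (X # Y # B # R @ T)" for Y
    by (rule D_mset_cong) (use Cons.prems in auto)
  ultimately have "D (X # Y # S @ B # T) = 0"
    using Cons.prems by (intro Cons.IH) auto
  moreover have "D (X # Y # S @ B # T) = D (X # Y # (B # S) @ T)"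
    by (rule D_mset_cong) (use Cons.prems Cons.hyps in auto)
  ultimately show ?case by simp
qed auto

end

section \<open>Mixed discriminants as polarized values\<close>

text \<open>Induction on the set of variables: for fixed values of the others, the sum is a polynomial in the
  new variable, and its coefficients are again such sums. Abstract indices \<open>m\<close> with exponents
  \<open>e m\<close> spare the restriction of exponent functions to fewer variables.\<close>

lemma monomials_independent:
  fixes c :: "'m \<Rightarrow> real" and e :: "'m \<Rightarrow> 'i \<Rightarrow> nat"
  assumes "finite S" "finite M"
    and "\<And>m m'. m \<in> M \<Longrightarrow> m' \<in> M \<Longrightarrow> (\<And>i. i \<in> S \<Longrightarrow> e m i = e m' i) \<Longrightarrow> m = m'"
    and "\<And>x. (\<Sum>m\<in>M. c m * (\<Prod>i\<in>S. x i ^ e m i)) = 0"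
    and "m \<in> M"
  shows "c m = 0"
  using assms
proof (induction S arbitrary: M m)
  case empty
  then have "M = {m}" by auto
  then show ?case using empty(3)[of "\<lambda>_. 0"] by simp
next
  case (insert j S)
  define N where "N = {m' \<in> M. e m' j = e m j}"
  show ?case
  proof (rule insert.IH[where M = N])
    show "finite N" "m \<in> N" using insert.prems by (auto simp: N_def)
    show "m1 = m2" if "m1 \<in> N" "m2 \<in> N" "\<And>i. i \<in> S \<Longrightarrow> e m1 i = e m2 i" for m1 m2
    proof (rule insert.prems(2))
      show "e m1 i = e m2 i" if "i \<in> insert j S" for i
        using that \<open>m1 \<in> N\<close> \<open>m2 \<in> N\<close> \<open>\<And>i. i \<in> S \<Longrightarrow> e m1 i = e m2 i\<close> by (auto simp: N_def)
    qed (use that in \<open>auto simp: N_def\<close>)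
    show "(\<Sum>m\<in>N. c m * (\<Prod>i\<in>S. x i ^ e m i)) = 0" for x
    proof -
      define p where "p = (\<Sum>m\<in>M. monom (c m * (\<Prod>i\<in>S. x i ^ e m i)) (e m j))"
      have "poly p t = 0" for t
      proof -
        have "poly p t = (\<Sum>m\<in>M. c m * (\<Prod>i\<in>insert j S. (x(j := t)) i ^ e m i))"
          unfolding p_def poly_sum
        proof (intro sum.cong refl)
          fix m
          have "(\<Prod>i\<in>S. (x(j := t)) i ^ e m i) = (\<Prod>i\<in>S. x i ^ e m i)"
            by (intro prod.cong refl) (use insert.hyps in auto)
          then show "poly (monom (c m * (\<Prod>i\<in>S. x i ^ e m i)) (e m j)) t
            = c m * (\<Prod>i\<in>insert j S. (x(j := t)) i ^ e m i)"
            using insert.hyps by (simp add: poly_monom)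
        qed
        then show ?thesis using insert.prems(3) by simp
      qed
      then have "p = 0" using poly_eq_poly_eq_iff[of p 0] by (simp add: fun_eq_iff)
      then have "0 = coeff p (e m j)" by simp
      also have "\<dots> = (\<Sum>m'\<in>M. if e m' j = e m j then c m' * (\<Prod>i\<in>S. x i ^ e m' i) else 0)"
        by (simp add: p_def coeff_sum)
      also have "\<dots> = (\<Sum>m\<in>N. c m * (\<Prod>i\<in>S. x i ^ e m i))"
        unfolding N_def by (rule sum.inter_filter[symmetric]) (rule insert.prems)
      finally show ?thesis by simp
    qed
  qed
qed

definition monom_eval :: "(nat \<Rightarrow>\<^sub>0 nat) \<Rightarrow> (nat \<Rightarrow> real) \<Rightarrow> real"
  where "monom_eval m x = (\<Prod>i\<in>Poly_Mapping.keys m. x i ^ Poly_Mapping.lookup m i)"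

lemma monom_eval_superset:
  assumes "finite S" "Poly_Mapping.keys m \<subseteq> S"
  shows "monom_eval m x = (\<Prod>i\<in>S. x i ^ Poly_Mapping.lookup m i)"
  unfolding monom_eval_def
  by (rule prod.mono_neutral_left) (use assms in \<open>auto simp: in_keys_iff\<close>)

lemma monom_eval_add: "monom_eval (m + m') x = monom_eval m x * monom_eval m' x"
proof -
  let ?S = "Poly_Mapping.keys m \<union> Poly_Mapping.keys m'"
  have "Poly_Mapping.keys (m + m') \<subseteq> ?S" by (rule keys_add)
  then show ?thesis
    by (simp add: monom_eval_superset[of ?S] lookup_add power_add prod.distrib)
qed

lemma monom_eval_sum_single:
  "monom_eval (\<Sum>j\<in>J. Poly_Mapping.single (g j) 1) x = (\<Prod>j\<in>J. x (g j))"
  by (induction J rule: infinite_finite_induct) (auto simp: monom_eval_add, simp_all add: monom_eval_def)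

lemma mpoly_eval_superset:
  assumes "finite M" "Poly_Mapping.keys p \<subseteq> M"
  shows "mpoly_eval p x = (\<Sum>m\<in>M. Poly_Mapping.lookup p m * monom_eval m x)"
  unfolding mpoly_eval_def monom_eval_def
  by (rule sum.mono_neutral_left) (use assms in \<open>auto simp: in_keys_iff\<close>)

lemma mpoly_eval_add: "mpoly_eval (p + q) x = mpoly_eval p x + mpoly_eval q x"
proof -
  let ?M = "Poly_Mapping.keys p \<union> Poly_Mapping.keys q"
  have "Poly_Mapping.keys (p + q) \<subseteq> ?M" by (rule keys_add)
  then show ?thesis
    by (simp add: mpoly_eval_superset[of ?M] lookup_add distrib_right sum.distrib)
qed

lemma mpoly_eval_0: "mpoly_eval 0 x = 0"
  by (simp add: mpoly_eval_def)

lemma mpoly_eval_single: "mpoly_eval (Poly_Mapping.single m c) x = c * monom_eval m x"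
  by (simp add: mpoly_eval_superset[of "{m}"])

lemma mpoly_eval_sum: "mpoly_eval (\<Sum>j\<in>J. p j) x = (\<Sum>j\<in>J. mpoly_eval (p j) x)"
  by (induction J rule: infinite_finite_induct) (auto simp: mpoly_eval_add mpoly_eval_0)

lemma mpoly_eval_sum_list: "mpoly_eval (\<Sum>j\<leftarrow>J. p j) x = (\<Sum>j\<leftarrow>J. mpoly_eval (p j) x)"
  by (induction J) (auto simp: mpoly_eval_add mpoly_eval_0)

lemma lookup_sum_list: "Poly_Mapping.lookup (\<Sum>j\<leftarrow>J. p j) m = (\<Sum>j\<leftarrow>J. Poly_Mapping.lookup (p j) m)"
  by (induction J) (auto simp: lookup_add)

lemma mpoly_eval_inject:
  assumes "\<And>x. mpoly_eval p x = mpoly_eval q x"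
  shows "p = q"
proof (rule poly_mapping_eqI)
  fix m
  let ?M = "Poly_Mapping.keys p \<union> Poly_Mapping.keys q"
  define S where "S = (\<Union>m\<in>?M. Poly_Mapping.keys m)"
  have S: "finite S" by (simp add: S_def)
  show "Poly_Mapping.lookup p m = Poly_Mapping.lookup q m"
  proof (cases "m \<in> ?M")
    case True
    have "Poly_Mapping.lookup p m - Poly_Mapping.lookup q m = 0"
    proof (rule monomials_independent[where M = ?M and S = S and e = Poly_Mapping.lookup])
      show "m1 = m2" if "m1 \<in> ?M" "m2 \<in> ?M"
        "\<And>i. i \<in> S \<Longrightarrow> Poly_Mapping.lookup m1 i = Poly_Mapping.lookup m2 i" for m1 m2
      proof (rule poly_mapping_eqI)
        fix i
        show "Poly_Mapping.lookup m1 i = Poly_Mapping.lookup m2 i"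
        proof (cases "i \<in> S")
          case False
          then have "i \<notin> Poly_Mapping.keys m1" "i \<notin> Poly_Mapping.keys m2"
            using that(1,2) unfolding S_def by blast+
          then show ?thesis by (simp add: in_keys_iff)
        qed (rule that(3))
      qed
      show "(\<Sum>m\<in>?M. (Poly_Mapping.lookup p m - Poly_Mapping.lookup q m) * (\<Prod>i\<in>S. x i ^ Poly_Mapping.lookup m i)) = 0" for x
      proof -
        have "(\<Prod>i\<in>S. x i ^ Poly_Mapping.lookup m i) = monom_eval m x" if "m \<in> ?M" for m
          by (rule monom_eval_superset[symmetric, OF S]) (use that in \<open>auto simp: S_def\<close>)
        then have "(\<Sum>m\<in>?M. (Poly_Mapping.lookup p m - Poly_Mapping.lookup q m) * (\<Prod>i\<in>S. x i ^ Poly_Mapping.lookup m i))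
          = (\<Sum>m\<in>?M. (Poly_Mapping.lookup p m - Poly_Mapping.lookup q m) * monom_eval m x)"
          by (intro sum.cong) simp_all
        also have "\<dots> = mpoly_eval p x - mpoly_eval q x"
          by (simp add: mpoly_eval_superset[of ?M] left_diff_distrib sum_subtractf)
        finally show ?thesis using assms by simp
      qed
    qed (use True S in simp_all)
    then show ?thesis by simp
  qed (simp add: in_keys_iff)
qed

lemma mpoly_of_fun_eq:
  assumes "\<And>x. mpoly_eval p x = f x"
  shows "mpoly_of_fun f = p"
  unfolding mpoly_of_fun_def
  by (rule the_equality) (use assms mpoly_eval_inject in auto)

lemma sum_single_eq_iff_permutation:
  fixes n :: nat
  assumes g: "g \<in> {..<n} \<rightarrow>\<^sub>E {..<n}"
  shows "(\<Sum>j<n. Poly_Mapping.single (g j) 1) = (\<Sum>j<n. Poly_Mapping.single j (1::nat)) \<longleftrightarrow> inj_on g {..<n}"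
    (is "?l = ?r \<longleftrightarrow> _")
proof
  have count: "Poly_Mapping.lookup (\<Sum>j<n. Poly_Mapping.single (h j) (1::nat)) i = card {j \<in> {..<n}. h j = i}" for h i
    using sum.inter_filter[of "{..<n}" "\<lambda>_. 1 :: nat" "\<lambda>j. h j = i"]
    by (simp add: lookup_sum lookup_single when_def del: One_nat_def)
  {
    assume eq: "?l = ?r"
    show "inj_on g {..<n}"
    proof (rule inj_onI)
      fix a b assume ab: "a \<in> {..<n}" "b \<in> {..<n}" "g a = g b"
      then have "g a < n" using g by auto
      have "card {j \<in> {..<n}. g j = g a} = card {j \<in> {..<n}. j = g a}"
        using count[of g "g a"] count[of "\<lambda>j. j" "g a"] eq by simp
      also have "{j \<in> {..<n}. j = g a} = {g a}" using \<open>g a < n\<close> by auto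
      finally obtain z where "{j \<in> {..<n}. g j = g a} = {z}" by (auto simp: card_1_singleton_iff)
      then show "a = b" using ab by (metis (mono_tags, lifting) mem_Collect_eq singletonD)
    qed
  }
  {
    assume inj: "inj_on g {..<n}"
    then have "bij_betw g {..<n} {..<n}"
      using g by (intro bij_betw_imageI endo_inj_surj) auto
    then show "?l = ?r"
      by (rule sum.reindex_bij_betw[of g _ _ "\<lambda>i. Poly_Mapping.single i 1"])
  }
qed

lemma sum_injective_functions_eq_sum_permutations:
  fixes n :: nat
  shows "(\<Sum>g | g \<in> {..<n} \<rightarrow>\<^sub>E {..<n} \<and> inj_on g {..<n}. f (restrict g {..<n})) = (\<Sum>\<sigma> | \<sigma> permutes {..<n}. f (restrict \<sigma> {..<n}))"
proof (rule sum.reindex_bij_witness[where i = "\<lambda>\<sigma>. restrict \<sigma> {..<n}" and j = "\<lambda>g x. if x < n then g x else x"])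
  fix g assume g: "g \<in> {g. g \<in> {..<n} \<rightarrow>\<^sub>E {..<n} \<and> inj_on g {..<n}}"
  then show "restrict (\<lambda>x. if x < n then g x else x) {..<n} = g"
    by (auto simp: fun_eq_iff PiE_def extensional_def)
  then show "f (restrict (\<lambda>x. if x < n then g x else x) {..<n}) = f (restrict g {..<n})"
    using g PiE_restrict[of g "{..<n}" "\<lambda>_. {..<n}"] by simp
  have "bij_betw g {..<n} {..<n}"
    using g by (intro bij_betw_imageI endo_inj_surj) auto
  then have "bij_betw (\<lambda>x. if x < n then g x else x) {..<n} {..<n}"
    using bij_betw_cong[of "{..<n}" "\<lambda>x. if x < n then g x else x" g] by simp
  then show "(\<lambda>x. if x < n then g x else x) \<in> {\<sigma>. \<sigma> permutes {..<n}}"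
    by (auto intro!: bij_imp_permutes split: if_splits)
next
  fix \<sigma> assume s: "\<sigma> \<in> {\<sigma>. \<sigma> permutes {..<n}}"
  then show "(\<lambda>x. if x < n then restrict \<sigma> {..<n} x else x) = \<sigma>"
    by (auto simp: fun_eq_iff permutes_not_in)
  show "restrict \<sigma> {..<n} \<in> {g. g \<in> {..<n} \<rightarrow>\<^sub>E {..<n} \<and> inj_on g {..<n}}"
    using s permutes_in_image[of \<sigma> "{..<n}"] permutes_inj[of \<sigma> "{..<n}"]
    by (auto simp: inj_on_def dest: injD)
qed

lemma perm_prod_eq_sum_rows:
  "perm_prod n us ws = (\<Sum>\<sigma> | \<sigma> permutes {..<n}. \<Prod>j<n. (ws ! \<sigma> j) (us ! j))"
proof -
  have "perm_prod n us ws = (\<Sum>\<sigma> | \<sigma> permutes {..<n}. \<Prod>i<n. (ws ! i) (us ! inv \<sigma> i))"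
    unfolding perm_prod_def by (rule sum_permutations_inverse)
  also have "\<dots> = (\<Sum>\<sigma> | \<sigma> permutes {..<n}. \<Prod>j<n. (ws ! \<sigma> j) (us ! j))"
  proof (intro sum.cong refl)
    fix \<sigma> assume "\<sigma> \<in> {\<sigma>. \<sigma> permutes {..<n}}"
    then have s: "\<sigma> permutes {..<n}" by simp
    show "(\<Prod>i<n. (ws ! i) (us ! inv \<sigma> i)) = (\<Prod>j<n. (ws ! \<sigma> j) (us ! j))"
      using prod.permute[OF s, of "\<lambda>i. (ws ! i) (us ! inv \<sigma> i)"] permutes_inverses(2)[OF s]
      by (simp add: o_def)
  qed
  finally show ?thesis .
qed

text \<open>Expanding each product of sums of linear functionals yields one monomial for every map of the \<open>n\<close> factors to the \<open>n\<close>
  variables. The monomial is the product of all variables exactly if the map is injective, and the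
  sum over these maps, the permutations, is the polarized form times \<open>n!\<close>.\<close>

lemma coefficient_of_polar:
  fixes As :: "'a::euclidean_space list" and F :: "(real \<times> 'a list) list"
  assumes len: "length As = n"
    and f: "\<And>x. f x = polar F n (replicate n (inner (\<Sum>i<n. x i *\<^sub>R As ! i)))"
  shows "Poly_Mapping.lookup (mpoly_of_fun f) (\<Sum>i<n. Poly_Mapping.single i 1)
    = fact n * polar F n (map inner As)"
proof -
  let ?G = "{..<n} \<rightarrow>\<^sub>E {..<n}"
  let ?mono = "\<lambda>g. \<Sum>j<n. Poly_Mapping.single (g j) (1::nat)"
  \<comment> \<open>The coefficients of this polynomial are visible, and it represents \<open>f\<close>.\<close>
  define p where "p = (\<Sum>(c, us)\<leftarrow>F. \<Sum>g\<in>?G. Poly_Mapping.single (?mono g) (c * (\<Prod>j<n. As ! g j \<bullet> us ! j)))"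
  have G: "finite ?G" by (intro finite_PiE) auto
  have "mpoly_eval p x = f x" for x
  proof -
    have "mpoly_eval p x = (\<Sum>(c, us)\<leftarrow>F. \<Sum>g\<in>?G. c * (\<Prod>j<n. As ! g j \<bullet> us ! j) * (\<Prod>j<n. x (g j)))"
      by (simp add: p_def mpoly_eval_sum_list mpoly_eval_sum mpoly_eval_single monom_eval_sum_single case_prod_unfold
          del: One_nat_def)
    also have "\<dots> = (\<Sum>(c, us)\<leftarrow>F. c * (\<Prod>j<n. \<Sum>i<n. x i * (As ! i \<bullet> us ! j)))"
      by (subst prod_sum_PiE) (simp_all add: sum_distrib_left prod.distrib mult_ac)
    also have "\<dots> = f x"
      unfolding f polar_replicate by (simp add: inner_sum_left)
    finally show ?thesis .
  qed
  then have "mpoly_of_fun f = p" by (rule mpoly_of_fun_eq)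
  then have "Poly_Mapping.lookup (mpoly_of_fun f) (?mono (\<lambda>i. i))
    = (\<Sum>(c, us)\<leftarrow>F. \<Sum>g\<in>?G. if ?mono g = ?mono (\<lambda>i. i) then c * (\<Prod>j<n. As ! g j \<bullet> us ! j) else 0)"
    by (simp add: p_def lookup_sum_list lookup_sum lookup_single when_def case_prod_unfold)
  also have "\<dots> = (\<Sum>(c, us)\<leftarrow>F. c * perm_prod n us (map inner As))"
  proof -
    have "(\<Sum>g\<in>?G. if ?mono g = ?mono (\<lambda>i. i) then c * (\<Prod>j<n. As ! g j \<bullet> us ! j) else 0)
      = c * perm_prod n us (map inner As)" for c us
    proof -
      have "(\<Sum>g\<in>?G. if ?mono g = ?mono (\<lambda>i. i) then c * (\<Prod>j<n. As ! g j \<bullet> us ! j) else 0)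
        = (\<Sum>g\<in>?G. if inj_on g {..<n} then c * (\<Prod>j<n. As ! g j \<bullet> us ! j) else 0)"
        using sum_single_eq_iff_permutation by (intro sum.cong) auto
      also have "\<dots> = (\<Sum>g | g \<in> ?G \<and> inj_on g {..<n}. c * (\<Prod>j<n. As ! (restrict g {..<n}) j \<bullet> us ! j))"
        using sum.inter_filter[OF G, of "\<lambda>g. c * (\<Prod>j<n. As ! g j \<bullet> us ! j)" "\<lambda>g. inj_on g {..<n}"] by simp
      also have "\<dots> = (\<Sum>\<sigma> | \<sigma> permutes {..<n}. c * (\<Prod>j<n. As ! (restrict \<sigma> {..<n}) j \<bullet> us ! j))"
        by (rule sum_injective_functions_eq_sum_permutations)
      also have "\<dots> = c * (\<Sum>\<sigma> | \<sigma> permutes {..<n}. \<Prod>j<n. As ! \<sigma> j \<bullet> us ! j)"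
        by (simp add: sum_distrib_left)
      also have "(\<Sum>\<sigma> | \<sigma> permutes {..<n}. \<Prod>j<n. As ! \<sigma> j \<bullet> us ! j) = perm_prod n us (map inner As)"
        unfolding perm_prod_eq_sum_rows
      proof (intro sum.cong prod.cong refl)
        fix \<sigma> j assume "\<sigma> \<in> {\<sigma>. \<sigma> permutes {..<n}}" "j \<in> {..<n}"
        then have "\<sigma> j < n" using permutes_in_image[of \<sigma> "{..<n}" j] by simp
        then show "As ! \<sigma> j \<bullet> us ! j = (map inner As ! \<sigma> j) (us ! j)" using len by simp
      qed
      finally show ?thesis .
    qed
    then show ?thesis by simp
  qed
  finally show ?thesis by (simp add: polar_def)
qed

section \<open>Homogeneous polynomials as diagonals of symmetric multilinear forms\<close>

lemma sum_list_product:
  "(\<Sum>x\<leftarrow>xs. f x) * (\<Sum>y\<leftarrow>ys. g y) = (\<Sum>(x, y)\<leftarrow>List.product xs ys. f x * g y :: real)"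
  by (induction xs) (simp_all add: distrib_right sum_list_const_mult o_def)

lemma real_polynomial_function_sum_of_products:
  fixes p :: "'a::euclidean_space \<Rightarrow> real"
  assumes "real_polynomial_function p"
  shows "\<exists>F. \<forall>x. p x = (\<Sum>(c, us)\<leftarrow>F. c * prod_list (map (inner x) us))"
  using assms
proof (induction rule: real_polynomial_function.induct)
  case (linear f)
  then have "f x = x \<bullet> adjoint f 1" for x
    using adjoint_works[of f x 1] by (simp add: linear_conv_bounded_linear)
  then show ?case by (intro exI[of _ "[(1, [adjoint f 1])]"]) simp
next
  case (const c)
  show ?case by (intro exI[of _ "[(c, [])]"]) simp
next
  case (add f g)
  then obtain F G where "\<forall>x. f x = (\<Sum>(c, us)\<leftarrow>F. c * prod_list (map (inner x) us))"
    "\<forall>x. g x = (\<Sum>(c, us)\<leftarrow>G. c * prod_list (map (inner x) us))" by blast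
  then show ?case by (intro exI[of _ "F @ G"]) simp
next
  case (mult f g)
  then obtain F G where FG: "\<forall>x. f x = (\<Sum>(c, us)\<leftarrow>F. c * prod_list (map (inner x) us))"
    "\<forall>x. g x = (\<Sum>(c, us)\<leftarrow>G. c * prod_list (map (inner x) us))" by blast
  have "f x * g x = (\<Sum>(c, us)\<leftarrow>map (\<lambda>((c, us), (d, vs)). (c * d, us @ vs)) (List.product F G).
      c * prod_list (map (inner x) us))" for x
    by (simp add: FG sum_list_product o_def case_prod_unfold mult_ac)
  then show ?case by blast
qed

text \<open>Homogeneity along rays in \<open>V\<close> singles out the products with exactly \<open>n\<close> factors: compare the
  coefficients of \<open>t ^ n\<close> in \<open>p (t *\<^sub>R x)\<close>.\<close>

lemma homogeneous_polynomial_sum_of_products: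
  fixes p :: "'a::euclidean_space \<Rightarrow> real"
  assumes "real_polynomial_function p"
    and "\<And>x t. x \<in> V \<Longrightarrow> p (t *\<^sub>R x) = t ^ n * p x"
  obtains F where "\<And>x. x \<in> V \<Longrightarrow> p x = polar F n (replicate n (inner x))"
proof -
  obtain F where F: "\<And>x. p x = (\<Sum>(c, us)\<leftarrow>F. c * prod_list (map (inner x) us))"
    using real_polynomial_function_sum_of_products[OF assms(1)] by blast
  let ?F = "filter (\<lambda>(c, us). length us = n) F"
  have "p x = polar ?F n (replicate n (inner x))" if x: "x \<in> V" for x
  proof -
    define q where "q = (\<Sum>(c, us)\<leftarrow>F. monom (c * prod_list (map (inner x) us)) (length us))"
    have scale: "prod_list (map (inner (t *\<^sub>R x)) us) = t ^ length us * prod_list (map (inner x) us)" for t us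
      by (induction us) simp_all
    have psl: "poly (\<Sum>a\<leftarrow>G. h a) t = (\<Sum>a\<leftarrow>G. poly (h a) t)" for G t and h :: "real \<times> 'a list \<Rightarrow> real poly"
      by (induction G) simp_all
    have csl: "coeff (\<Sum>a\<leftarrow>G. h a) k = (\<Sum>a\<leftarrow>G. coeff (h a) k)" for G k and h :: "real \<times> 'a list \<Rightarrow> real poly"
      by (induction G) simp_all
    have "poly q t = p (t *\<^sub>R x)" for t
      unfolding F by (simp add: q_def psl scale poly_monom case_prod_unfold mult_ac)
    then have "poly q t = poly (monom (p x) n) t" for t
      using assms(2)[OF x] by (simp add: poly_monom mult.commute)
    then have "q = monom (p x) n" using poly_eq_poly_eq_iff by blast
    then have "p x = coeff q n" by simp
    also have "\<dots> = (\<Sum>(c, us)\<leftarrow>F. if length us = n then c * prod_list (map (inner x) us) else 0)"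
      by (simp add: q_def csl case_prod_unfold)
    also have "\<dots> = (\<Sum>(c, us)\<leftarrow>?F. c * (\<Prod>i<n. x \<bullet> us ! i))"
      by (induction F) (auto simp: prod.list_conv_set_nth atLeast0LessThan)
    also have "\<dots> = polar ?F n (replicate n (inner x))"
      by (simp add: polar_replicate)
    finally show ?thesis .
  qed
  then show thesis using that by blast
qed

section \<open>The Moore determinant has no zeros over the tube of the positive cone\<close>

text \<open>If \<open>S + iT\<close> annihilates \<open>a + ib\<close>, then \<open>S a = T b\<close> and \<open>S b = - T a\<close>. The symmetry of \<open>S\<close> turns this into
  \<open>b \<bullet> T b + a \<bullet> T a = 0\<close>, so both \<open>a\<close> and \<open>b\<close> are zero.\<close>

lemma det_complex_definite_nonzero:
  fixes S T :: "real^'m^'m"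
  assumes S: "\<And>x y. x \<bullet> (S *v y) = y \<bullet> (S *v x)"
    and T: "\<And>x. x \<noteq> 0 \<Longrightarrow> x \<bullet> (T *v x) > 0"
  shows "det (\<chi> p q. Complex (S $ p $ q) (T $ p $ q)) \<noteq> 0"
proof -
  let ?M = "\<chi> p q. Complex (S $ p $ q) (T $ p $ q)"
  have "v = 0" if v: "?M *v v = 0" for v
  proof -
    define a where "a = (\<chi> i. Re (v $ i))"
    define b where "b = (\<chi> i. Im (v $ i))"
    have re: "(S *v a) $ i = (T *v b) $ i" for i
    proof -
      have "Re ((?M *v v) $ i) = 0" using v by simp
      then show ?thesis
        by (simp add: a_def b_def matrix_vector_mult_def sum_subtractf)
    qed
    have im: "(S *v b) $ i = (- (T *v a)) $ i" for i
    proof -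
      have "Im ((?M *v v) $ i) = 0" using v by simp
      then show ?thesis
        by (simp add: a_def b_def matrix_vector_mult_def sum.distrib eq_neg_iff_add_eq_0)
    qed
    have "S *v a = T *v b"
      by (rule vec_eq_iff[THEN iffD2]) (rule allI, rule re)
    moreover have "S *v b = - (T *v a)"
      by (rule vec_eq_iff[THEN iffD2]) (rule allI, rule im)
    ultimately have sum0: "b \<bullet> (T *v b) + a \<bullet> (T *v a) = 0"
      using S[of a b] by simp
    have nonneg: "x \<bullet> (T *v x) \<ge> 0" for x
      by (cases "x = 0") (use T[of x] in auto)
    have "a = 0"
    proof (rule ccontr)
      assume "a \<noteq> 0"
      with sum0 T[of a] nonneg[of b] show False by linarith
    qed
    moreover have "b = 0"
    proof (rule ccontr)
      assume "b \<noteq> 0"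
      with sum0 T[of b] nonneg[of a] show False by linarith
    qed
    ultimately have "a $ i = 0" "b $ i = 0" for i by simp_all
    then show "v = 0" by (simp add: a_def b_def vec_eq_iff complex_eq_iff)
  qed
  then have "\<exists>B. B ** ?M = mat 1"
    unfolding matrix_left_invertible_ker by blast
  then obtain B where "B ** ?M = mat 1" ..
  then have "det (B ** ?M) = 1"
    by (simp only: det_I)
  then show ?thesis
    by (auto simp: det_mul)
qed

definition quat_vector :: "real^('n \<times> 4) \<Rightarrow> quat^'n"
  where "quat_vector x = (\<Sum>p\<in>UNIV. x $ p *\<^sub>R real_basis p)"

lemma inner_real_matrix: "x \<bullet> (real_matrix A *v y) = quat_vector x \<bullet> (A *v quat_vector y)"
proof -
  have "A *v quat_vector y = (\<Sum>q\<in>UNIV. y $ q *\<^sub>R (A *v real_basis q))"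
    by (simp add: quat_vector_def linear_sum[OF linear_quat_matrix] linear_scale[OF linear_quat_matrix])
  then show ?thesis
    by (simp add: inner_vec_def[where 'b = "'a \<times> 4"] matrix_vector_mult_def[of "real_matrix A"] real_matrix_nth
        inner_sum_right inner_sum_left quat_vector_def[of x] sum_distrib_left mult_ac)
       (rule sum.swap)
qed

lemma quat_vector_eq_0:
  fixes x :: "real^('n::finite \<times> 4)"
  assumes 0: "quat_vector x = 0"
  shows "x = 0"
proof -
  have on: "real_basis p \<bullet> real_basis q = (if p = q then 1 else 0)" for p q :: "'n \<times> 4"
    using quat_unit_orthonormal[of "snd p" "snd q"]
    by (auto simp: real_basis_def inner_axis_axis inner_quat_def prod_eq_iff)
  have "x $ p = 0" for p
  proof -
    have "real_basis p \<bullet> quat_vector x = (\<Sum>q\<in>UNIV. if p = q then x $ q else 0)"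
      unfolding quat_vector_def inner_sum_right by (intro sum.cong) (simp_all add: on)
    then show ?thesis using 0 by simp
  qed
  then show ?thesis by (simp add: vec_eq_iff)
qed

lemma det_real_matrix_complex_nonzero:
  assumes X: "hyperhermitian X" and Y: "positive_definite Y"
  shows "det (\<chi> p q. Complex (real_matrix X $ p $ q) (real_matrix Y $ p $ q)) \<noteq> 0"
proof (rule det_complex_definite_nonzero)
  show "x \<bullet> (real_matrix X *v y) = y \<bullet> (real_matrix X *v x)" for x y
    using hyperhermitian_inner[OF X, of "quat_vector y" "quat_vector x"]
    by (simp only: inner_real_matrix inner_commute[of "quat_vector x"])
  show "x \<bullet> (real_matrix Y *v x) > 0" if "x \<noteq> 0" for x
  proof -
    have "quat_vector x \<noteq> 0" using that quat_vector_eq_0 by blast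
    then show ?thesis
      using Y by (simp add: inner_real_matrix positive_definite_def sesq_form_eq_qip inner_eq_qip)
  qed
qed

lemma real_matrix_affine: "real_matrix (X + t *\<^sub>R Y) $ p $ q = real_matrix X $ p $ q + t * real_matrix Y $ p $ q"
  by (simp add: real_matrix_def sesq_form_def qRe_sum distrib_left distrib_right sum.distrib
          sum_distrib_left del: quat_mult_sel(5))

lemma poly_eq_on_reals:
  fixes a b :: "complex poly"
  assumes "\<And>t. poly a (of_real t) = poly b (of_real t)"
  shows "a = b"
proof (rule ccontr)
  assume "a \<noteq> b"
  then have "finite {z. poly (a - b) z = 0}" by (intro poly_roots_finite) simp
  moreover have "range complex_of_real \<subseteq> {z. poly (a - b) z = 0}" using assms by auto
  ultimately have "finite (range complex_of_real)" by (rule finite_subset[rotated])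
  then show False
    using finite_imageD[of complex_of_real UNIV] infinite_UNIV_char_0[where 'a = real] by (simp add: inj_of_real)
qed

text \<open>The identity between the fourth power of \<open>P\<close> and the determinant of the real matrix holds at \<open>X + tY\<close>
  for real \<open>t\<close>, hence as an identity of polynomials in \<open>t\<close>, and may be evaluated at the imaginary unit.\<close>

lemma polar_moore_complex_nonzero:
  fixes F :: "(real \<times> (quat^'n^'n) list) list"
  assumes P: "moore_polynomial P" and F: "\<And>X. hyperhermitian X \<Longrightarrow> P X = polar F n (replicate n (inner X))"
    and X: "hyperhermitian X" and Y: "positive_definite Y"
  shows "polar F n (replicate n (cpoint X Y)) \<noteq> 0"
proof -
  define a where "a = (\<Sum>(c, us)\<leftarrow>F. smult (complex_of_real c)
    (\<Prod>i<n. [:complex_of_real (X \<bullet> us ! i), complex_of_real (Y \<bullet> us ! i):]))"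
  define b where "b = (\<Sum>\<sigma> | \<sigma> permutes (UNIV :: ('n \<times> 4) set). of_int (sign \<sigma>) *
    (\<Prod>p\<in>UNIV. [:complex_of_real (real_matrix X $ p $ \<sigma> p), complex_of_real (real_matrix Y $ p $ \<sigma> p):]))"
  have psl: "poly (\<Sum>x\<leftarrow>G. h x) t = (\<Sum>x\<leftarrow>G. poly (h x) t)"
    for G t and h :: "real \<times> (quat^'n^'n) list \<Rightarrow> complex poly"
    by (induction G) simp_all
  have poly_of_int: "poly (of_int k) z = (of_int k :: complex)" for k z
    by (simp add: of_int_poly)
  have a: "poly a z = (\<Sum>(c, us)\<leftarrow>F. of_real c * (\<Prod>i<n. of_real (X \<bullet> us ! i) + z * of_real (Y \<bullet> us ! i)))" for z
    by (simp add: a_def psl case_prod_unfold poly_prod)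
  have b: "poly b z = det (\<chi> p q. of_real (real_matrix X $ p $ q) + z * of_real (real_matrix Y $ p $ q))" for z
    by (simp add: b_def poly_sum poly_prod poly_of_int det_def)
  have herm: "hyperhermitian (X + t *\<^sub>R Y)" for t
    using subspace_hyperhermitian X Y unfolding positive_definite_def
    by (metis mem_Collect_eq subspace_add subspace_scale)
  have "poly (a ^ 4) (of_real t) = poly b (of_real t)" for t
  proof -
    have "poly a (of_real t) = of_real (P (X + t *\<^sub>R Y))"
      unfolding F[OF herm] polar_replicate a
      by (simp add: of_real_sum_list_map case_prod_unfold o_def inner_add_left)
    moreover have "poly b (of_real t) = of_real (det (real_matrix (X + t *\<^sub>R Y)))"
      by (simp add: b det_def real_matrix_affine)
    ultimately show ?thesis
      using P herm[of t] by (simp add: moore_polynomial_def poly_power)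
  qed
  then have "a ^ 4 = b" by (rule poly_eq_on_reals)
  then have "poly a \<i> ^ 4 = poly b \<i>" by (metis poly_power)
  moreover have "poly b \<i> \<noteq> 0"
    using det_real_matrix_complex_nonzero[OF X Y] by (simp add: b Complex_eq)
  moreover have "poly a \<i> = polar F n (replicate n (cpoint X Y))"
    by (simp add: a polar_replicate cpoint_def Complex_eq)
  ultimately show ?thesis by auto
qed

section \<open>Signature of a form that is negative on a hyperplane\<close>

text \<open>Semidefiniteness on the complement \<open>W\<close> of \<open>e\<close> is definiteness: a null vector in \<open>W\<close> would be orthogonal
  to \<open>W\<close> and to \<open>e\<close>, hence in the radical. The Gram-Schmidt process in \<open>W\<close> then yields an orthogonal
  basis of negative vectors, to which \<open>e\<close> is added.\<close>

lemma signature_one_plus: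
  fixes B :: "'a::euclidean_space \<Rightarrow> 'a \<Rightarrow> real"
  assumes V: "subspace V" and bil: "symmetric_bilinear_on V B" and nd: "nondegenerate_on V B"
    and e: "e \<in> V" "B e e > 0" and neg: "\<And>x. x \<in> V \<Longrightarrow> B x e = 0 \<Longrightarrow> B x x \<le> 0"
  shows "has_signature_on V B 1 (dim V - 1)"
proof -
  have sym: "B x y = B y x" if "x \<in> V" "y \<in> V" for x y
    using bil that by (simp add: symmetric_bilinear_on_def)
  have add: "B (a *\<^sub>R x + b *\<^sub>R y) z = a * B x z + b * B y z" if "x \<in> V" "y \<in> V" "z \<in> V" for x y z a b
    using bil that by (simp add: symmetric_bilinear_on_def)
  have zero: "B 0 z = 0" if "z \<in> V" for z
    using add[of 0 0 z 0 0] V that by (simp add: subspace_0)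
  have sum: "B (\<Sum>c\<in>C. r c *\<^sub>R c) z = (\<Sum>c\<in>C. r c * B c z)" if "finite C" "C \<subseteq> V" "z \<in> V" for C r z
    using that
  proof (induction C)
    case (insert c C)
    have "(\<Sum>c\<in>C. r c *\<^sub>R c) \<in> V"
      using insert V by (intro subspace_sum subspace_scale) auto
    then show ?case
      using insert add[of c "\<Sum>c\<in>C. r c *\<^sub>R c" z "r c" 1] by simp
  qed (simp add: zero)
  define W where "W = {x \<in> V. B x e = 0}"
  have W: "subspace W"
    unfolding subspace_def W_def
  proof (intro conjI ballI allI; clarsimp)
    show "0 \<in> V \<and> B 0 e = 0" using V e zero by (simp add: subspace_0)
    show "x + y \<in> V \<and> B (x + y) e = 0" if "x \<in> V" "B x e = 0" "y \<in> V" "B y e = 0" for x y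
      using that V e add[of x y e 1 1] by (simp add: subspace_add)
    show "c *\<^sub>R x \<in> V \<and> B (c *\<^sub>R x) e = 0" if "x \<in> V" "B x e = 0" for x c
      using that V e add[of x x e c 0] by (simp add: subspace_scale)
  qed
  have split: "\<exists>a. y - a *\<^sub>R e \<in> W" if y: "y \<in> V" for y
  proof
    have "B (y - (B y e / B e e) *\<^sub>R e) e = 0"
      using add[of y e e 1 "- (B y e / B e e)"] y e by simp
    then show "y - (B y e / B e e) *\<^sub>R e \<in> W"
      using y e V by (simp add: W_def subspace_diff subspace_scale)
  qed
  have W_neg: "B x x < 0" if x: "x \<in> W" "x \<noteq> 0" for x
  proof (rule ccontr)
    assume "\<not> ?thesis"
    with neg x have xx: "B x x = 0" by (force simp: W_def)
    have xV: "x \<in> V" and xe: "B x e = 0" using x by (auto simp: W_def)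
    have xW: "B x w = 0" if w: "w \<in> W" for w
    proof (rule linear_dominates_quadratic)
      fix t
      have wV: "w \<in> V" using w by (simp add: W_def)
      let ?u = "x + t *\<^sub>R w"
      have u: "?u \<in> W" using W x w by (intro subspace_add subspace_scale)
      then have uV: "?u \<in> V" and le: "B ?u ?u \<le> 0" using neg by (auto simp: W_def)
      have "B ?u ?u = B x ?u + t * B w ?u" using add[of x w ?u 1 t] xV wV uV by simp
      also have "B x ?u = B x x + t * B x w"
        using add[of x w x 1 t] xV wV uV sym by simp
      also have "B w ?u = B x w + t * B w w"
        using add[of x w w 1 t] xV wV uV sym by simp
      finally show "2 * t * B x w + t\<^sup>2 * B w w \<le> 0"
        using le xx by (simp add: power2_eq_square algebra_simps)
    qed
    have "B x y = 0" if y: "y \<in> V" for y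
    proof -
      obtain a where a: "y - a *\<^sub>R e \<in> W" using split[OF y] ..
      have "y - a *\<^sub>R e \<in> V" using a by (simp add: W_def)
      then have "B y x = B (y - a *\<^sub>R e) x + a * B e x"
        using add[of "y - a *\<^sub>R e" e x 1 a] e xV by simp
      then show ?thesis
        using xW[OF a] xe sym xV y e \<open>y - a *\<^sub>R e \<in> V\<close> by simp
    qed
    then show False
      using nd x xV by (auto simp: nondegenerate_on_def)
  qed
  have W_sub: "W \<subseteq> V" by (auto simp: W_def)
  have gram_schmidt: "\<exists>C. finite C \<and> C \<subseteq> W \<and> 0 \<notin> C \<and> span C = span T \<and>
      (\<forall>c\<in>C. \<forall>c'\<in>C. c \<noteq> c' \<longrightarrow> B c c' = 0)" if "finite T" "T \<subseteq> W" for T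
    using that
  proof (induction T)
    case empty
    show ?case by (intro exI[of _ "{}"]) simp
  next
    case (insert t T)
    then have "\<exists>C. finite C \<and> C \<subseteq> W \<and> 0 \<notin> C \<and> span C = span T \<and>
        (\<forall>c\<in>C. \<forall>c'\<in>C. c \<noteq> c' \<longrightarrow> B c c' = 0)"
      by simp
    then obtain C where C: "finite C" "C \<subseteq> W" "0 \<notin> C" "span C = span T"
      and C_orth: "\<forall>c\<in>C. \<forall>c'\<in>C. c \<noteq> c' \<longrightarrow> B c c' = 0"
      by (elim exE conjE)
    have orth: "B c c' = 0" if "c \<in> C" "c' \<in> C" "c \<noteq> c'" for c c'
      using C_orth that by simp
    define s where "s = (\<Sum>c\<in>C. (B t c / B c c) *\<^sub>R c)"
    define u where "u = t - s"
    have s_span: "s \<in> span C"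
      unfolding s_def by (intro span_sum span_scale span_base)
    have sW: "s \<in> W"
      using span_minimal[OF C(2) W] s_span by blast
    have tW: "t \<in> W" using insert.prems by simp
    have uW: "u \<in> W" unfolding u_def using W tW sW by (rule subspace_diff)
    have uc: "B u c = 0" if c: "c \<in> C" for c
    proof -
      have cV: "c \<in> V" using c C W_sub by auto
      have "B s c = (\<Sum>c'\<in>C. B t c' / B c' c' * B c' c)"
        unfolding s_def by (rule sum) (use C cV W_sub in auto)
      also have "\<dots> = (\<Sum>c'\<in>C. if c' = c then B t c' else 0)"
      proof (rule sum.cong)
        fix c' assume "c' \<in> C"
        moreover have "B c c \<noteq> 0" using W_neg[of c] c C by fastforce
        ultimately show "B t c' / B c' c' * B c' c = (if c' = c then B t c' else 0)"
          using orth c by auto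
      qed simp
      also have "\<dots> = B t c" using C c by simp
      finally show ?thesis
        using add[of t s c 1 "-1"] tW sW W_sub cV by (auto simp: u_def)
    qed
    have span_u: "span (insert u C) = span (insert t T)"
    proof -
      have "span (insert u C) = span (insert t C)"
        by (rule eq_span_insert_eq) (use s_span in \<open>simp add: u_def span_neg\<close>)
      also have "\<dots> = span (insert t T)"
        using C(4) by (simp add: span_insert)
      finally show ?thesis .
    qed
    show ?case
    proof (cases "u = 0")
      case True
      then have "span C = span (insert t T)" using span_u by simp
      with C C_orth show ?thesis by (intro exI[of _ C]) simp
    next
      case False
      have "B c u = 0" if "c \<in> C" for c
        using uc[OF that] sym[of u c] uW W_sub C that by auto
      then have "\<forall>c\<in>insert u C. \<forall>c'\<in>insert u C. c \<noteq> c' \<longrightarrow> B c c' = 0"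
        using C_orth uc by simp
      with C(1-3) uW False span_u show ?thesis
        by (intro exI[of _ "insert u C"]) simp
    qed
  qed
  obtain T where T: "T \<subseteq> W" "independent T" "W \<subseteq> span T"
    by (rule basis_exists[of W])
  have T_span: "span T = W" and T_fin: "finite T"
    using span_subspace[OF T(1,3) W] finiteI_independent[OF T(2)] by simp_all
  obtain C where C: "finite C" "C \<subseteq> W" "0 \<notin> C" "span C = W"
    and C_orth: "\<forall>c\<in>C. \<forall>c'\<in>C. c \<noteq> c' \<longrightarrow> B c c' = 0"
    using gram_schmidt[OF T_fin T(1)] unfolding T_span by (elim exE conjE)
  have eC: "e \<notin> C" using C(2) e by (auto simp: W_def)
  let ?E = "insert e C"
  have EV: "?E \<subseteq> V" using C W_sub e by auto
  have Corth: "B c e = 0" "B e c = 0" if "c \<in> C" for c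
    using C(2) that sym[of c e] e(1) by (auto simp: W_def)
  have Eorth: "B x y = 0" if "x \<in> ?E" "y \<in> ?E" "x \<noteq> y" for x y
    using that C_orth Corth by auto
  have Cneg: "B c c < 0" if "c \<in> C" for c
  proof (rule W_neg)
    show "c \<in> W" "c \<noteq> 0" using that C(2,3) by blast+
  qed
  have E_indep: "independent ?E"
  proof (rule independent_if_scalars_zero)
    show "finite ?E" using C by simp
    fix r x assume 0: "(\<Sum>x\<in>?E. r x *\<^sub>R x) = 0" and x: "x \<in> ?E"
    have "0 = B (\<Sum>x\<in>?E. r x *\<^sub>R x) x" unfolding 0 using zero[of x] x EV by auto
    also have "\<dots> = (\<Sum>y\<in>?E. r y * B y x)" by (rule sum) (use C(1) EV x in auto)
    also have "\<dots> = (\<Sum>y\<in>?E. if y = x then r x * B x x else 0)"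
      by (intro sum.cong) (use Eorth x in auto)
    also have "\<dots> = r x * B x x" using C(1) x by simp
    finally have "r x * B x x = 0" ..
    moreover have "B x x \<noteq> 0" using x Cneg[of x] e(2) by (cases "x = e") auto
    ultimately show "r x = 0" by simp
  qed
  have E_span: "span ?E = V"
  proof
    show "span ?E \<subseteq> V" using EV V by (rule span_minimal)
    show "V \<subseteq> span ?E"
    proof
      fix y assume "y \<in> V"
      then obtain a where "y - a *\<^sub>R e \<in> span C" using split C(4) by blast
      then show "y \<in> span ?E" unfolding span_insert by blast
    qed
  qed
  have "span V = V" using V by (simp only: span_eq_iff)
  then have "span ?E = span V" unfolding E_span by (rule HOL.sym)
  then have card_E: "dim V = card ?E" using E_indep by (rule dim_eq_card)
  have signs: "{x \<in> ?E. B x x > 0} = {e}" "{x \<in> ?E. B x x < 0} = C"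
  proof -
    have "\<not> B c c > 0" if "c \<in> C" for c using Cneg[OF that] by simp
    then show "{x \<in> ?E. B x x > 0} = {e}" using e(2) by blast
    have "\<not> B e e < 0" using e(2) by simp
    then show "{x \<in> ?E. B x x < 0} = C" using Cneg by blast
  qed
  show ?thesis
    unfolding has_signature_on_def
  proof (intro exI[of _ ?E] conjI)
    show "finite ?E" using C(1) by simp
    show "independent ?E" by (rule E_indep)
    show "span ?E = V" by (rule E_span)
    show "\<forall>x\<in>?E. \<forall>y\<in>?E. x \<noteq> y \<longrightarrow> B x y = 0" using Eorth by blast
    show "card {x \<in> ?E. B x x > 0} = 1" unfolding signs by simp
    show "card {x \<in> ?E. B x x < 0} = dim V - 1" using C(1) eC unfolding signs card_E by simp
  qed
qed

section \<open>The cone of positive definite matrices\<close>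

lemma positive_definite_iff_inner:
  "positive_definite A \<longleftrightarrow> hyperhermitian A \<and> (\<forall>x. x \<noteq> 0 \<longrightarrow> x \<bullet> (A *v x) > 0)"
  by (simp add: positive_definite_def sesq_form_eq_qip inner_eq_qip)

lemma quat_matrix_combine: "(A + t *\<^sub>R B) *v x = A *v x + t *\<^sub>R (B *v x)" for A B :: "quat^'n^'n"
  by (simp add: matrix_vector_mult_def vec_eq_iff scaleR_sum_right distrib_right sum.distrib)

lemma quat_matrix_scaleR: "(t *\<^sub>R B) *v x = t *\<^sub>R (B *v x)" for B :: "quat^'n^'n"
  by (simp add: matrix_vector_mult_def vec_eq_iff scaleR_sum_right)

lemma hyperhermitian_closed:
  "hyperhermitian A \<Longrightarrow> hyperhermitian B \<Longrightarrow> hyperhermitian (A + B)"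
  "hyperhermitian A \<Longrightarrow> hyperhermitian (t *\<^sub>R A)"
  using subspace_hyperhermitian by (auto simp: subspace_def)

lemma positive_definite_mat_1: "positive_definite (mat 1)"
  by (simp add: positive_definite_iff_inner hyperhermitian_mat_1)

lemma positive_definite_add:
  "positive_definite A \<Longrightarrow> positive_definite B \<Longrightarrow> positive_definite (A + B)"
  using quat_matrix_combine[of A 1 B] by (auto simp: positive_definite_iff_inner hyperhermitian_closed inner_add_right add_pos_pos)

lemma positive_definite_scale:
  "t > 0 \<Longrightarrow> positive_definite A \<Longrightarrow> positive_definite (t *\<^sub>R A)"
  by (auto simp: positive_definite_iff_inner hyperhermitian_closed quat_matrix_scaleR)

lemma nonneg_definite_add_positive:
  assumes "nonneg_definite A" "t > 0"
  shows "positive_definite (A + t *\<^sub>R mat 1)"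
proof -
  have "x \<bullet> (A *v x) \<ge> 0" for x
    using assms(1) by (cases "x = 0") (auto simp: nonneg_definite_def sesq_form_eq_qip inner_eq_qip[symmetric])
  then show ?thesis
    using assms unfolding positive_definite_iff_inner quat_matrix_combine
    by (auto simp: nonneg_definite_def hyperhermitian_closed hyperhermitian_mat_1 inner_add_right add_nonneg_pos)
qed

text \<open>With \<open>m > 0\<close> the minimum of the form of \<open>A\<close> on the unit sphere and \<open>- k\<close> a lower bound for that of
  \<open>X\<close>, any \<open>e > 0\<close> with \<open>e * k < m\<close> does.\<close>

lemma positive_definite_open:
  fixes A X :: "quat^'n^'n"
  assumes A: "positive_definite A" and X: "hyperhermitian X"
  shows "\<exists>e>0. positive_definite (A + e *\<^sub>R X)"
proof -
  let ?S = "sphere 0 1 :: (quat^'n) set"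
  have cont: "continuous_on ?S (\<lambda>x. x \<bullet> (B *v x))" for B :: "quat^'n^'n"
    by (intro continuous_intros linear_continuous_on_compose[OF continuous_on_id linear_quat_matrix, unfolded id_def])
  have ne: "?S \<noteq> {}" by (simp add: sphere_eq_empty)
  obtain a where a: "a \<in> ?S" "\<And>x. x \<in> ?S \<Longrightarrow> a \<bullet> (A *v a) \<le> x \<bullet> (A *v x)"
    using continuous_attains_inf[OF compact_sphere ne cont] by blast
  obtain b where b: "b \<in> ?S" "\<And>x. x \<in> ?S \<Longrightarrow> b \<bullet> (X *v b) \<le> x \<bullet> (X *v x)"
    using continuous_attains_inf[OF compact_sphere ne cont] by blast
  define m where "m = a \<bullet> (A *v a)"
  define k where "k = \<bar>b \<bullet> (X *v b)\<bar>"
  have "a \<noteq> 0" using a(1) by auto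
  then have m: "m > 0" using A by (simp add: m_def positive_definite_iff_inner)
  define e where "e = m / (k + 1)"
  have k: "k \<ge> 0" by (simp add: k_def)
  have e: "e > 0" "e * k < m"
    using m k by (simp_all add: e_def field_simps)
  have sphere: "x \<bullet> ((A + e *\<^sub>R X) *v x) > 0" if "x \<in> ?S" for x
  proof -
    have "- k \<le> x \<bullet> (X *v x)" using b(2)[OF that] by (simp add: k_def)
    then have "e * (- k) \<le> e * (x \<bullet> (X *v x))" using e(1) by (intro mult_left_mono) auto
    then show ?thesis
      using a(2)[OF that] e(2) by (simp add: quat_matrix_combine inner_add_right m_def)
  qed
  have "x \<bullet> ((A + e *\<^sub>R X) *v x) > 0" if "x \<noteq> 0" for x
  proof -
    let ?y = "x /\<^sub>R norm x"
    have "?y \<bullet> ((A + e *\<^sub>R X) *v ?y) > 0" using that by (intro sphere) simp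
    then show ?thesis
      using that by (simp add: linear_scale[OF linear_quat_matrix] zero_less_mult_iff)
  qed
  then show ?thesis
    using e(1) A X by (auto simp: positive_definite_iff_inner hyperhermitian_closed)
qed

lemma coeff_linear_mult:
  fixes q :: "'a::comm_ring_1 poly"
  shows "coeff ([:1, a:] * q) 0 = coeff q 0"
    and "coeff ([:1, a:] * q) (Suc k) = coeff q (Suc k) + a * coeff q k"
  by simp_all

lemma coeff_prod_linear:
  fixes l :: "'i \<Rightarrow> real"
  assumes "finite S"
  shows "coeff (\<Prod>i\<in>S. [:1, l i:]) 0 = 1 \<and> coeff (\<Prod>i\<in>S. [:1, l i:]) 1 = (\<Sum>i\<in>S. l i) \<and>
    2 * coeff (\<Prod>i\<in>S. [:1, l i:]) 2 = (\<Sum>i\<in>S. l i)\<^sup>2 - (\<Sum>i\<in>S. (l i)\<^sup>2)"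
  using assms
proof (induction S)
  case (insert j S)
  define q where "q = (\<Prod>i\<in>S. [:1, l i:])"
  have q: "(\<Prod>i\<in>insert j S. [:1, l i:]) = [:1, l j:] * q"
    unfolding q_def using insert.hyps by (rule prod.insert)
  have IH: "coeff q 0 = 1" "coeff q 1 = (\<Sum>i\<in>S. l i)"
    "2 * coeff q 2 = (\<Sum>i\<in>S. l i)\<^sup>2 - (\<Sum>i\<in>S. (l i)\<^sup>2)"
    using insert.IH by (simp_all only: q_def)
  have 0: "coeff ([:1, l j:] * q) 0 = 1"
    unfolding coeff_linear_mult by (rule IH)
  have 1: "coeff ([:1, l j:] * q) 1 = (\<Sum>i\<in>S. l i) + l j"
    using coeff_linear_mult(2)[of "l j" q 0] IH by (simp only: One_nat_def mult_1_right)
  have 2: "coeff ([:1, l j:] * q) 2 = coeff q 2 + l j * (\<Sum>i\<in>S. l i)"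
    using coeff_linear_mult(2)[of "l j" q 1] IH by (simp only: Suc_1)
  have "2 * coeff ([:1, l j:] * q) 2 = (l j + (\<Sum>i\<in>S. l i))\<^sup>2 - ((l j)\<^sup>2 + (\<Sum>i\<in>S. (l i)\<^sup>2))"
    using IH(3) unfolding 2 by (simp add: power2_eq_square algebra_simps)
  then show ?case
    using insert.hyps unfolding q 0 1 by (simp add: add.commute)
qed simp

section \<open>The polarized Moore determinant\<close>

text \<open>The Moore polynomial together with a presentation of it as the diagonal of a symmetric multilinear
  form.\<close>

locale moore_form =
  fixes P :: "quat^'n^'n \<Rightarrow> real" and F
  assumes P: "moore_polynomial P"
    and P_eigen: "\<And>A l v. hyperhermitian A \<Longrightarrow> eigensystem A l v \<Longrightarrow> P A = (\<Prod>i\<in>UNIV. l i)"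
    and F: "\<And>X. hyperhermitian X \<Longrightarrow> P X = polar F CARD('n) (replicate CARD('n) (inner X))"
begin

lemma moore_pos: "positive_definite Y \<Longrightarrow> P Y > 0"
proof -
  assume Y: "positive_definite Y"
  then have h: "hyperhermitian Y" by (simp add: positive_definite_def)
  obtain l v where e: "eigensystem Y l v" using eigensystem_exists[OF h] .
  have "l i > 0" for i
    using eigensystem_eigenvalue[OF e, of i] Y by (simp add: positive_definite_def)
  then show "P Y > 0" using P_eigen[OF h e] by (simp add: prod_pos)
qed

sublocale hyperbolic_form F "CARD('n)" "{X. hyperhermitian X}" "{X. positive_definite X}"
proof
  show "subspace {X :: quat^'n^'n. hyperhermitian X}" by (rule subspace_hyperhermitian)
  show "{X. positive_definite X} \<subseteq> {X :: quat^'n^'n. hyperhermitian X}"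
    by (auto simp: positive_definite_def)
  show "polar F CARD('n) (replicate CARD('n) (inner Y)) > 0" if "Y \<in> {X. positive_definite X}" for Y
    using that F[of Y] moore_pos[of Y] by (simp add: positive_definite_def)
  show "polar F CARD('n) (replicate CARD('n) (cpoint X Y)) \<noteq> 0"
    if "X \<in> {X. hyperhermitian X}" "Y \<in> {X. positive_definite X}" for X Y
    using polar_moore_complex_nonzero[OF P F] that by auto
qed (use positive_definite_add positive_definite_scale positive_definite_open in auto)

lemma mixed_discriminant_eq:
  fixes As :: "(quat^'n^'n) list"
  assumes "length As = CARD('n)" "\<And>A. A \<in> set As \<Longrightarrow> hyperhermitian A"
  shows "mixed_discriminant As = polar F CARD('n) (map inner As)"
proof -
  have "hyperhermitian (\<Sum>i<CARD('n). x i *\<^sub>R As ! i)" for x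
  proof -
    have "(\<Sum>i<CARD('n). x i *\<^sub>R As ! i) \<in> {A. hyperhermitian A}"
      using assms by (intro subspace_sum subspace_scale subspace_hyperhermitian) auto
    then show ?thesis by simp
  qed
  then have "moore_det (\<Sum>i<CARD('n). x i *\<^sub>R As ! i)
    = polar F CARD('n) (replicate CARD('n) (inner (\<Sum>i<CARD('n). x i *\<^sub>R As ! i)))" for x
    using moore_det_eq[OF P] F by simp
  from coefficient_of_polar[OF assms(1) this] show ?thesis
    unfolding mixed_discriminant_def by simp
qed

lemma mixed_discriminant_pos:
  fixes As :: "(quat^'n^'n) list"
  assumes "length As = CARD('n)" "\<And>A. A \<in> set As \<Longrightarrow> positive_definite A"
  shows "mixed_discriminant As > 0"
  using D_pos[of As] mixed_discriminant_eq[of As] assms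
  by (auto simp: positive_definite_def subset_iff D_def)

text \<open>A non-negative definite matrix becomes positive definite when \<open>t > 0\<close> times the identity is added.
  Replacing one matrix at a time makes the limit \<open>t \<rightarrow> 0\<close> one of an affine function of \<open>t\<close>.\<close>

lemma D_nonneg:
  assumes "\<And>A. A \<in> set Ss \<Longrightarrow> nonneg_definite A" "\<And>A. A \<in> set R \<Longrightarrow> positive_definite A"
    "length Ss + length R = CARD('n)"
  shows "D (Ss @ R) \<ge> 0"
  using assms
proof (induction Ss arbitrary: R)
  case Nil
  then show ?case using D_pos[of R] by (simp add: subset_iff less_imp_le)
next
  case (Cons A Ss)
  have move: "D (Ss @ B # R) = D (B # Ss @ R)" for B
    by (rule D_mset_cong) (use Cons.prems in auto)
  have "D (A # Ss @ R) + t * D (mat 1 # Ss @ R) \<ge> 0" if t: "t > 0" for t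
  proof -
    have "D (Ss @ (A + t *\<^sub>R mat 1) # R) \<ge> 0"
      by (rule Cons.IH) (use Cons.prems nonneg_definite_add_positive[OF _ t] in auto)
    then show ?thesis
      unfolding move by (simp add: D_linear)
  qed
  then have lim: "\<forall>\<^sub>F t in at_right 0. D (A # Ss @ R) + t * D (mat 1 # Ss @ R) \<ge> 0"
    by (auto simp: eventually_at_right_less intro: eventually_mono[OF eventually_at_right_less])
  have "((\<lambda>t. D (A # Ss @ R) + t * D (mat 1 # Ss @ R)) \<longlongrightarrow> D (A # Ss @ R) + 0 * D (mat 1 # Ss @ R)) (at_right 0)"
    by (intro tendsto_intros)
  from tendsto_lowerbound[OF this lim] show ?case by simp
qed

lemma mixed_discriminant_nonneg:
  fixes As :: "(quat^'n^'n) list"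
  assumes "length As = CARD('n)" "\<And>A. A \<in> set As \<Longrightarrow> nonneg_definite A"
  shows "mixed_discriminant As \<ge> 0"
  using D_nonneg[of As "[]"] mixed_discriminant_eq[of As] assms
  by (auto simp: nonneg_definite_def D_def)

text \<open>The polynomial \<open>P (1 + tX)\<close> is the product of the \<open>1 + t l\<close> over the eigenvalues \<open>l\<close> of \<open>X\<close>, and
  its coefficients are the values \<open>D (X, \<dots>, X, 1, \<dots>, 1)\<close> times binomial coefficients. The radical
  condition with \<open>Y = 1\<close> and \<open>Y = X\<close> makes the coefficients of \<open>t\<close> and \<open>t\<^sup>2\<close> vanish, so
  the sum of the \<open>l\<^sup>2\<close> is zero.\<close>

lemma radical_at_identity:
  assumes n: "CARD('n) \<ge> 2" and X: "hyperhermitian X"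
    and rad: "\<And>Y. hyperhermitian Y \<Longrightarrow> D (X # Y # replicate (CARD('n) - 2) (mat 1)) = 0"
  shows "X = 0"
proof -
  obtain l v where e: "eigensystem X l v" using eigensystem_exists[OF X] .
  let ?I = "mat 1 :: quat^'n^'n"
  let ?n = "CARD('n)"
  let ?d = "\<lambda>j. D (replicate j X @ replicate (?n - j) ?I)"
  define q where "q = (\<Sum>j\<le>?n. monom (of_nat (?n choose j) * ?d j) j)"
  have "poly q t = poly (\<Prod>i\<in>UNIV. [:1, l i:]) t" for t
  proof -
    have "poly q t = D (replicate ?n (?I + t *\<^sub>R X) @ [])"
      by (subst D_binomial) (simp_all add: q_def poly_sum poly_monom)
    also have "\<dots> = P (?I + t *\<^sub>R X)"
      by (simp add: D_def F hyperhermitian_closed hyperhermitian_mat_1 X)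
    also have "\<dots> = (\<Prod>i\<in>UNIV. 1 + t * l i)"
      using eigensystem_affine[OF e, of 1 t] by (intro P_eigen) (auto simp: hyperhermitian_closed hyperhermitian_mat_1 X)
    finally show ?thesis by (simp add: poly_prod)
  qed
  then have q: "q = (\<Prod>i\<in>UNIV. [:1, l i:])" using poly_eq_poly_eq_iff by blast
  have coeff_q: "coeff q j = of_nat (?n choose j) * ?d j" if "j \<le> ?n" for j
    using that by (simp add: q_def coeff_sum)
  have I: "replicate (?n - 1) ?I = ?I # replicate (?n - 2) ?I"
    using n by (metis Suc_diff_Suc Suc_1 less_eq_Suc_le replicate_Suc)
  have "?d 1 = 0"
    using rad[OF hyperhermitian_mat_1] I by simp
  then have "coeff q 1 = 0" using coeff_q[of 1] n by simp
  then have l1: "(\<Sum>i\<in>UNIV. l i) = 0"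
    unfolding q using coeff_prod_linear[of UNIV l] by simp
  have "?d 2 = 0"
    using rad[OF X] by (simp add: numeral_2_eq_2)
  then have "coeff q 2 = 0" using coeff_q[of 2] n by simp
  then have "(\<Sum>i\<in>UNIV. (l i)\<^sup>2) = 0"
    unfolding q using coeff_prod_linear[of UNIV l] l1 by simp
  then have "l i = 0" for i
    by (simp add: sum_nonneg_eq_0_iff)
  then show "X = 0" by (rule hyperhermitian_eq_0[OF X e])
qed

text \<open>The Hodge inequality with \<open>Y\<close> the identity is the hypothesis on the hyperplane in
  \<open>signature_one_plus\<close>; non-degeneracy is transferred from the case in which all fixed matrices are
  the identity.\<close>

lemma mixed_discriminant_signature:
  fixes As :: "(quat^'n^'n) list"
  assumes n: "CARD('n) \<ge> 2" and As: "length As = CARD('n) - 2" "\<And>A. A \<in> set As \<Longrightarrow> positive_definite A"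
  defines "V \<equiv> {X :: quat^'n^'n. hyperhermitian X}"
    and "B \<equiv> \<lambda>X Y. mixed_discriminant (X # Y # As)"
  shows "symmetric_bilinear_on V B \<and> nondegenerate_on V B \<and> has_signature_on V B 1 (dim V - 1)"
proof -
  have len: "length As + 2 = CARD('n)" using As n by simp
  have B: "B X Y = D (X # Y # As)" if "X \<in> V" "Y \<in> V" for X Y
    using mixed_discriminant_eq[of "X # Y # As"] that len As
    by (auto simp: B_def V_def D_def positive_definite_def)
  have Vs: "subspace V" unfolding V_def by (rule subspace_hyperhermitian)
  have K: "set As \<subseteq> {X. positive_definite X}" using As by auto
  have lin: "D ((a *\<^sub>R X + b *\<^sub>R Y) # Z # As) = a * D (X # Z # As) + b * D (Y # Z # As)" for X Y Z a b
    using D_linear[of "a *\<^sub>R X" b Y "Z # As"] D_linear[of 0 a X "Z # As"] D_linear[of 0 "-1" 0 "Z # As"] by simp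
  have bil: "symmetric_bilinear_on V B"
    unfolding symmetric_bilinear_on_def
  proof (intro conjI ballI allI)
    show "B X Y = B Y X" if "X \<in> V" "Y \<in> V" for X Y
      using that len by (auto simp: B intro: D_mset_cong)
    show "B (a *\<^sub>R X + b *\<^sub>R Y) Z = a * B X Z + b * B Y Z" if "X \<in> V" "Y \<in> V" "Z \<in> V" for X Y Z a b
    proof -
      have "a *\<^sub>R X + b *\<^sub>R Y \<in> V" using that Vs by (intro subspace_add subspace_scale)
      then show ?thesis using that by (simp add: B lin)
    qed
  qed
  have nd: "nondegenerate_on V B"
    unfolding nondegenerate_on_def
  proof (intro ballI impI)
    fix X assume X: "X \<in> V" and rad: "\<forall>Y\<in>V. B X Y = 0"
    let ?Is = "replicate (CARD('n) - 2) (mat 1 :: quat^'n^'n)"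
    have "D (X # Y # ?Is @ []) = 0" if "hyperhermitian Y" for Y
    proof (rule radical_independent[of As])
      show "set (As @ ?Is @ []) \<subseteq> {X. positive_definite X}"
        using K positive_definite_mat_1 by auto
      show "D (X # Y # As @ []) = 0" if "Y \<in> {X. hyperhermitian X}" for Y
        using rad X that B[of X Y] by (simp add: V_def)
    qed (use X that As len in \<open>auto simp: V_def\<close>)
    then show "X = 0"
      using radical_at_identity[OF n] X by (simp add: V_def)
  qed
  have I: "mat 1 \<in> V" by (simp add: V_def hyperhermitian_mat_1)
  have "has_signature_on V B 1 (dim V - 1)"
  proof (rule signature_one_plus[OF Vs bil nd I])
    show "B (mat 1) (mat 1) > 0"
      unfolding B_def using As len positive_definite_mat_1 by (intro mixed_discriminant_pos) auto
    show "B X X \<le> 0" if "X \<in> V" "B X (mat 1) = 0" for X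
      using D_hodge[OF K len, of X "mat 1"] that I positive_definite_mat_1 by (simp add: B V_def)
  qed
  with bil nd show ?thesis by blast
qed

end

theorem theorem1p1p15:
  shows
    "(\<forall>As :: (quat^'n^'n) list.
        length As = CARD('n) \<longrightarrow> (\<forall>A\<in>set As. positive_definite A) \<longrightarrow>
          mixed_discriminant As > 0) \<and>
     (\<forall>As :: (quat^'n^'n) list.
        length As = CARD('n) \<longrightarrow> (\<forall>A\<in>set As. nonneg_definite A) \<longrightarrow>
          mixed_discriminant As \<ge> 0) \<and>
     (CARD('n) \<ge> 2 \<longrightarrow>
       (\<forall>As :: (quat^'n^'n) list.
          length As = CARD('n) - 2 \<longrightarrow> (\<forall>A\<in>set As. positive_definite A) \<longrightarrow>
            (let V = {X :: quat^'n^'n. hyperhermitian X};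
                 B = (\<lambda>X Y. mixed_discriminant (X # Y # As))
             in symmetric_bilinear_on V B \<and> nondegenerate_on V B \<and>
                has_signature_on V B 1 (dim V - 1))))"
proof -
  obtain P where P: "moore_polynomial P"
    and eigen: "\<And>(A :: quat^'n^'n) l v. hyperhermitian A \<Longrightarrow> eigensystem A l v \<Longrightarrow> P A = (\<Prod>i\<in>UNIV. l i)"
    using moore_polynomial_exists[where 'n = 'n] by blast
  have hom: "P (t *\<^sub>R X) = t ^ CARD('n) * P X" if "X \<in> {X. hyperhermitian X}" for X t
  proof -
    have X: "hyperhermitian X" using that by simp
    obtain l v where e: "eigensystem X l v" using eigensystem_exists[OF X] .
    have "eigensystem (t *\<^sub>R X) (\<lambda>i. t * l i) v"
      using eigensystem_affine[OF e, of 0 t] by simp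
    from eigen[OF hyperhermitian_closed(2)[OF X] this] eigen[OF X e] show ?thesis
      by (simp add: prod.distrib)
  qed
  have "real_polynomial_function P" using P by (simp add: moore_polynomial_def)
  then obtain F where "\<And>X. X \<in> {X. hyperhermitian X} \<Longrightarrow> P X = polar F CARD('n) (replicate CARD('n) (inner X))"
    using homogeneous_polynomial_sum_of_products[of P "{X. hyperhermitian X}" "CARD('n)"] hom by blast
  then have F: "\<And>X. hyperhermitian X \<Longrightarrow> P X = polar F CARD('n) (replicate CARD('n) (inner X))"
    by simp
  interpret moore_form P F
    by unfold_locales (fact P eigen F)+
  show ?thesis
    unfolding Let_def
    using mixed_discriminant_pos mixed_discriminant_nonneg mixed_discriminant_signature by blast
qed

end
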